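(* For every real $x>1$, $$\sum_{n=0}^{+\infty}(-1)^{n-1}\ell_n L_n(\log x)=\begin{cases}\tfrac12 & \text{if } x\in\{2,3,4,\dots\},\\ \{x\} & \text{otherwise,}\end{cases}$$ where the series converges (pointwise) at every such $x$.
   Context: $\{x\}=x-\lfloor x\rfloor$. $L_n(u)=\sum_{k=0}^n\binom{n}{k}\frac{(-1)^k}{k!}u^k$ are the Laguerre polynomials. With Stieltjes constants $\gamma_n=\lim_{N\to\infty}\left(\sum_{k=1}^N\frac{\log^n k}{k}-\frac{\log^{n+1}N}{n+1}\right)$, the coefficients are $\ell_0=\gamma_0-1$ and $\ell_n=\sum_{k=1}^n\binom{n-1}{k-1}\frac{(-1)^{n-k}}{k!}\gamma_k$ for $n\ge1$. *)

theory Defs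
  imports "HOL-Analysis.Analysis"
begin

definition stieltjes :: "nat \<Rightarrow> real" where
  "stieltjes n = lim (\<lambda>N. (\<Sum>k=1..N. ln (real k) ^ n / real k)
                         - ln (real N) ^ (n + 1) / real (n + 1))"

definition laguerre :: "nat \<Rightarrow> real \<Rightarrow> real" where
  "laguerre n u = (\<Sum>k=0..n. real (n choose k) * (-1) ^ k / fact k * u ^ k)"

definition ell :: "nat \<Rightarrow> real" where
  "ell n = (if n = 0 then stieltjes 0 - 1
            else (\<Sum>k=1..n. real ((n - 1) choose (k - 1)) * (-1) ^ (n - k) / fact k * stieltjes k))"

end

theory Submission
  imports Defs "HOL-Real_Asymp.Real_Asymp"
begin

text \<open>
  With \<open>u = log x\<close>, the series is the Fourier--Laguerre series of \<open>f(v) = {e\<^sup>v}\<close> for the weight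
  \<open>e\<^sup>-\<^sup>v\<close> on \<open>(0, \<infinity>)\<close>: Euler summation expresses \<open>\<gamma>\<^sub>k\<close> as an integral of \<open>f\<close> against
  \<open>(v\<^sup>k e\<^sup>-\<^sup>v)'\<close>, and \<open>e\<^sup>-\<^sup>v L\<^sub>n(v)\<close> is a combination of these derivatives, with coefficients
  that turn \<open>\<integral> f L\<^sub>n e\<^sup>-\<^sup>v\<close> into \<open>(-1)\<^sup>n\<^sup>-\<^sup>1 \<ell>\<^sub>n\<close>.

  By the Christoffel--Darboux formula, the error of a partial sum at \<open>u\<close> is the integral of the
  difference quotient \<open>(f(v) - f(u)) / (v - u)\<close> against
  \<open>(u L\<^sub>n'(u) L\<^sub>n(v) - L\<^sub>n(u) v L\<^sub>n'(v)) e\<^sup>-\<^sup>v\<close>. The bounds \<open>L\<^sub>n(v) = O(n\<^sup>-\<^sup>1\<^sup>/\<^sup>4)\<close> and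
  \<open>L\<^sub>n'(v) = O(n\<^sup>1\<^sup>/\<^sup>4)\<close>, obtained from energy functionals of the Laguerre equation, dominate
  these kernels by a fixed integrable function, and an explicit primitive shows that their integrals
  over \<open>(0, d)\<close> tend to 0. So the error tends to 0 whenever the difference quotient is
  bounded. If \<open>x\<close> is an integer, the jump is removed by adding the step function at \<open>u\<close>,
  whose own series at \<open>u\<close> telescopes to \<open>1/2\<close>.
\<close>

section \<open>Laguerre polynomials and their energy functionals\<close>

lemma laguerre_0 [simp]: "laguerre 0 u = 1"
  by (simp add: laguerre_def)

lemma laguerre_at_0 [simp]: "laguerre n 0 = 1"
proof -
  have "laguerre n 0 = (\<Sum>k\<in>{0..n}. if k = 0 then 1 else 0)"
    unfolding laguerre_def by (intro sum.cong) (auto simp: power_0_left)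
  then show ?thesis by simp
qed

text \<open>Pascal's rule leaves (n choose k) in degree k + 1. Differentiating then cancels one
  factor of the factorial and yields minus the coefficients of \<open>laguerre n\<close>.\<close>

lemma laguerre_Suc_diff:
  "laguerre (Suc n) u - laguerre n u
    = (\<Sum>k=0..n. real (n choose k) * (-1) ^ Suc k / fact (Suc k) * u ^ Suc k)"
proof -
  let ?c = "\<lambda>m k. real (m choose k) * (-1) ^ k / fact k * u ^ k"
  have shift: "(\<Sum>k=0..Suc n. ?c m k) = 1 + (\<Sum>k=0..n. ?c m (Suc k))" for m
    by (subst sum.atLeast0_atMost_Suc_shift) simp
  have "laguerre (Suc n) u = 1 + (\<Sum>k=0..n. ?c (Suc n) (Suc k))"
    unfolding laguerre_def by (rule shift)
  \<comment> \<open>The coefficient (n choose n + 1) is 0, so both polynomials can be summed over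
    the same range.\<close>
  moreover have "(\<Sum>k=0..Suc n. ?c n k) = (\<Sum>k=0..n. ?c n k)"
    by simp
  then have "laguerre n u = 1 + (\<Sum>k=0..n. ?c n (Suc k))"
    unfolding laguerre_def shift by simp
  ultimately have "laguerre (Suc n) u - laguerre n u = (\<Sum>k=0..n. ?c (Suc n) (Suc k) - ?c n (Suc k))"
    by (simp only: sum_subtractf)
  also have "\<dots> = (\<Sum>k=0..n. real (n choose k) * (-1) ^ Suc k / fact (Suc k) * u ^ Suc k)"
    by (intro sum.cong refl)
       (simp add: ring_distribs add_divide_distrib diff_divide_distrib del: fact_Suc power_Suc)
  finally show ?thesis .
qed

text \<open>The derivative of \<open>laguerre n\<close>, encoded through L_n' = -(L_0 + ... +
  L_{n-1}), which follows from (L_{n+1} - L_n)' = -L_n. The recurrence in n is then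
  immediate.\<close>

definition laguerre_deriv :: "nat \<Rightarrow> real \<Rightarrow> real" where
  "laguerre_deriv n u = - (\<Sum>k<n. laguerre k u)"

lemma laguerre_deriv_0 [simp]: "laguerre_deriv 0 u = 0"
  by (simp add: laguerre_deriv_def)

lemma laguerre_deriv_Suc: "laguerre_deriv (Suc n) u = laguerre_deriv n u - laguerre n u"
  by (simp add: laguerre_deriv_def)

lemma sum_power_Suc_has_deriv:
  fixes c :: "nat \<Rightarrow> real"
  shows "((\<lambda>u. \<Sum>k=0..n. c k * u ^ Suc k) has_real_derivative
    (\<Sum>k=0..n. c k * (real (Suc k) * u ^ k))) (at u within S)"
  by (auto intro!: derivative_eq_intros sum.cong simp del: power_Suc)

lemma laguerre_Suc_diff_has_deriv:
  "((\<lambda>u. laguerre (Suc n) u - laguerre n u) has_real_derivative - laguerre n u) (at u within S)"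
proof -
  have "((\<lambda>u. \<Sum>k=0..n. real (n choose k) * (-1) ^ Suc k / fact (Suc k) * u ^ Suc k) has_real_derivative
      (\<Sum>k=0..n. real (n choose k) * (-1) ^ Suc k / fact (Suc k) * (real (Suc k) * u ^ k))) (at u within S)"
    by (rule sum_power_Suc_has_deriv)
  moreover have "(\<Sum>k=0..n. real (n choose k) * (-1) ^ Suc k / fact (Suc k) * (real (Suc k) * u ^ k))
      = - laguerre n u"
    unfolding laguerre_def sum_negf[symmetric]
    by (intro sum.cong refl) (simp add: divide_simps del: of_nat_Suc)
  ultimately show ?thesis
    by (simp only: laguerre_Suc_diff)
qed

lemma laguerre_has_deriv [derivative_intros]:
  "(laguerre n has_real_derivative laguerre_deriv n u) (at u within S)"
proof (induction n)
  case 0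
  have "laguerre 0 = (\<lambda>_. 1)" by auto
  then show ?case by simp
next
  case (Suc n)
  from DERIV_add[OF laguerre_Suc_diff_has_deriv[of n] Suc]
  have "((\<lambda>x. laguerre (Suc n) x - laguerre n x + laguerre n x) has_real_derivative
      laguerre_deriv (Suc n) u) (at u within S)"
    by (simp add: laguerre_deriv_Suc)
  then show ?case
    by (simp only: diff_add_cancel)
qed

text \<open>The absorption identity (k + 1) (n + 1 choose k + 1) = (n + 1) (n choose k) matches u
  times the termwise derivative with the coefficients in \<open>laguerre_Suc_diff\<close>.\<close>

lemma laguerre_deriv_Suc_mult:
  "u * laguerre_deriv (Suc n) u = real (Suc n) * (laguerre (Suc n) u - laguerre n u)"
proof -
  let ?c = "\<lambda>k. real (Suc n choose Suc k) * (-1) ^ Suc k / fact (Suc k)"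
  have "laguerre (Suc n) = (\<lambda>u. 1 + (\<Sum>k=0..n. ?c k * u ^ Suc k))"
    unfolding laguerre_def[abs_def] by (subst sum.atLeast0_atMost_Suc_shift) simp
  moreover have "((\<lambda>u. 1 + (\<Sum>k=0..n. ?c k * u ^ Suc k)) has_real_derivative
      0 + (\<Sum>k=0..n. ?c k * (real (Suc k) * u ^ k))) (at u)"
    by (rule DERIV_add[OF DERIV_const sum_power_Suc_has_deriv])
  ultimately have "laguerre_deriv (Suc n) u
      = (\<Sum>k=0..n. real (Suc n choose Suc k) * (-1) ^ Suc k / fact (Suc k) * (real (Suc k) * u ^ k))"
    by (intro DERIV_unique[OF laguerre_has_deriv]) (simp only: add_0)
  then have "u * laguerre_deriv (Suc n) u
    = (\<Sum>k=0..n. u * (real (Suc n choose Suc k) * (-1) ^ Suc k / fact (Suc k) * (real (Suc k) * u ^ k)))"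
    by (simp only: sum_distrib_left)
  also have "\<dots> = (\<Sum>k=0..n. real (Suc n) * (real (n choose k) * (-1) ^ Suc k / fact (Suc k) * u ^ Suc k))"
  proof (intro sum.cong refl)
    fix k
    have "real (Suc k) * real (Suc n choose Suc k) = real (Suc n) * real (n choose k)"
      using Suc_times_binomial_eq[of n k] by (metis mult.commute of_nat_mult)
    then have "(real (Suc k) * real (Suc n choose Suc k)) * ((-1) ^ Suc k / fact (Suc k) * u ^ Suc k)
      = (real (Suc n) * real (n choose k)) * ((-1) ^ Suc k / fact (Suc k) * u ^ Suc k)"
      by (simp only:)
    then show "u * (real (Suc n choose Suc k) * (-1) ^ Suc k / fact (Suc k) * (real (Suc k) * u ^ k))
      = real (Suc n) * (real (n choose k) * (-1) ^ Suc k / fact (Suc k) * u ^ Suc k)"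
      by (simp only: power_Suc times_divide_eq_right times_divide_eq_left mult_ac)
  qed
  finally show ?thesis
    by (simp only: laguerre_Suc_diff sum_distrib_left)
qed

text \<open>The derivative form of the formula pairs each L_n with some v L_n', whose growth rates
  in n are reciprocal. In the induction step all values are rewritten through L_n and L_{n+1}',
  after which it is an algebraic identity.\<close>

lemma laguerre_christoffel_darboux:
  "(u - v) * (\<Sum>k<n. laguerre k u * laguerre k v)
    = v * laguerre n u * laguerre_deriv n v - u * laguerre_deriv n u * laguerre n v"
proof (induction n)
  case (Suc n)
  define A B A' B' where "A = laguerre n u" and "B = laguerre n v"
    and "A' = laguerre_deriv (Suc n) u" and "B' = laguerre_deriv (Suc n) v"
  have L: "laguerre (Suc n) u = A + u * A' / real (Suc n)" "laguerre (Suc n) v = B + v * B' / real (Suc n)"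
    using laguerre_deriv_Suc_mult[of u n] laguerre_deriv_Suc_mult[of v n]
    by (simp_all add: A_def B_def A'_def B'_def del: of_nat_Suc)
  have D: "laguerre_deriv n u = A' + A" "laguerre_deriv n v = B' + B"
    by (simp_all add: A_def B_def A'_def B'_def laguerre_deriv_Suc)
  have "(u - v) * (\<Sum>k<Suc n. laguerre k u * laguerre k v)
      = v * A * (B' + B) - u * (A' + A) * B + (u - v) * A * B"
    using Suc by (simp add: A_def[symmetric] B_def[symmetric] D distrib_left)
  also have "\<dots> = v * laguerre (Suc n) u * B' - u * A' * laguerre (Suc n) v"
    unfolding L by (simp add: algebra_simps add_divide_distrib)
  finally show ?case by (simp add: A'_def B'_def)
qed simp

text \<open>This is the Laguerre equation v y'' + (1 - v) y' + n y = 0. Keeping v y' together makes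
  it valid at v = 0 as well; it results from differentiating n (L_n - L_{n-1}).\<close>

lemma laguerre_deriv_mult_has_deriv:
  "((\<lambda>v. v * laguerre_deriv n v) has_real_derivative v * laguerre_deriv n v - real n * laguerre n v)
     (at v within S)"
proof (cases n)
  case (Suc m)
  have "((\<lambda>v. real (Suc m) * (laguerre (Suc m) v - laguerre m v))
      has_real_derivative real (Suc m) * - laguerre m v) (at v within S)"
    by (rule DERIV_cmult[OF laguerre_Suc_diff_has_deriv])
  moreover have "real (Suc m) * - laguerre m v = v * laguerre_deriv n v - real n * laguerre n v"
    using laguerre_deriv_Suc_mult[of v m] by (simp add: Suc algebra_simps)
  ultimately show ?thesis
    by (simp add: Suc laguerre_deriv_Suc_mult del: of_nat_Suc)
qed simp

lemma laguerre_deriv_has_deriv: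
  assumes "v > 0"
  shows "(laguerre_deriv n has_real_derivative
    laguerre_deriv n v - (real n * laguerre n v + laguerre_deriv n v) / v) (at v within S)"
proof -
  have "((\<lambda>v. (v * laguerre_deriv n v) / v) has_real_derivative
      ((v * laguerre_deriv n v - real n * laguerre n v) * v - (v * laguerre_deriv n v) * 1) / (v * v)) (at v)"
    using assms by (intro DERIV_divide laguerre_deriv_mult_has_deriv DERIV_ident) auto
  then have "(laguerre_deriv n has_real_derivative
      ((v * laguerre_deriv n v - real n * laguerre n v) * v - (v * laguerre_deriv n v) * 1) / (v * v)) (at v)"
    by (rule has_field_derivative_transform_within_open[where S = "{0<..}"]) (use assms in auto)
  moreover have "((v * laguerre_deriv n v - real n * laguerre n v) * v - (v * laguerre_deriv n v) * 1) / (v * v)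
     = laguerre_deriv n v - (real n * laguerre n v + laguerre_deriv n v) / v"
    using assms by (simp add: field_simps)
  ultimately show ?thesis
    by (metis has_field_derivative_at_within)
qed

text \<open>By the Laguerre equation the left side has derivative (2v - 1) L_n'(v)^2 / n, so it
  decreases on [0, 1/2] from its value 1 at 0.\<close>

lemma laguerre_energy_near_0:
  assumes "n > 0" "0 \<le> v" "v \<le> 1 / 2"
  shows "(laguerre n v)\<^sup>2 + v / real n * (laguerre_deriv n v)\<^sup>2 \<le> 1"
proof -
  let ?L = "laguerre n" and ?D = "laguerre_deriv n"
  have cD: "continuous_on UNIV ?D"
    unfolding laguerre_deriv_def laguerre_def by (intro continuous_intros) auto
  have cL: "continuous_on UNIV ?L"
    unfolding laguerre_def by (intro continuous_intros) auto
  define G where "G = (\<lambda>v. (?L v)\<^sup>2 + v / real n * (?D v)\<^sup>2)"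
  have "G v \<le> G 0"
  proof (rule DERIV_nonpos_imp_decreasing_open[OF assms(2)])
    show "continuous_on {0..v} G"
      unfolding G_def
      by (intro continuous_intros continuous_on_subset[OF cD] continuous_on_subset[OF cL]) (use assms in auto)
    fix x assume x: "0 < x" "x < v"
    define D' where "D' = ?D x - (real n * ?L x + ?D x) / x"
    have D': "(?D has_real_derivative D') (at x)" "x * D' = x * ?D x - (real n * ?L x + ?D x)"
      using laguerre_deriv_has_deriv[OF x(1)] x by (auto simp: D'_def right_diff_distrib)
    \<comment> \<open>The reciprocal becomes a variable subject to n r = 1, which turns the
      cancellation into a polynomial identity.\<close>
    define r where "r = 1 / real n"
    have r: "real n * r = 1"
      using assms by (simp add: r_def)
    have "(G has_real_derivative
        2 * ?L x * ?D x + r * (?D x)\<^sup>2 + x * r * (2 * ?D x * D')) (at x)"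
      unfolding G_def divide_inverse
      by (rule derivative_eq_intros D' refl)+ (simp add: r_def divide_inverse)
    also have "2 * ?L x * ?D x + r * (?D x)\<^sup>2 + x * r * (2 * ?D x * D') = (2 * x - 1) * (?D x)\<^sup>2 * r"
      using D'(2) r by algebra
    finally have "(G has_real_derivative (2 * x - 1) * (?D x)\<^sup>2 / real n) (at x)"
      by (simp add: r_def)
    moreover have "(2 * x - 1) * (?D x)\<^sup>2 / real n \<le> 0"
      using x assms by (intro divide_nonpos_nonneg mult_nonpos_nonneg) auto
    ultimately show "\<exists>y. (G has_real_derivative y) (at x) \<and> y \<le> 0" by blast
  qed
  then show ?thesis by (simp add: G_def)
qed

text \<open>
  The function \<open>\<phi>(t) = exp (-t\<^sup>2/2) \<surd>t L\<^sub>n(t\<^sup>2)\<close> satisfies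
  \<open>\<phi>'' + Q \<phi> = 0\<close> with the decreasing \<open>Q(t) = 4n + 2 - t\<^sup>2 + 1/(4t\<^sup>2)\<close>, so that
  \<open>\<phi>'\<^sup>2 + Q \<phi>\<^sup>2\<close> decreases; this quantity is the following expression.
\<close>

definition laguerre_energy :: "nat \<Rightarrow> real \<Rightarrow> real" where
  "laguerre_energy n t = exp (- t\<^sup>2) * (4 * t ^ 3 * (laguerre_deriv n (t\<^sup>2))\<^sup>2
      + 2 * (t - 2 * t ^ 3) * laguerre n (t\<^sup>2) * laguerre_deriv n (t\<^sup>2)
      + ((4 * real n + 1) * t + 1 / (2 * t)) * (laguerre n (t\<^sup>2))\<^sup>2)"

text \<open>The derivative of phi'^2 + Q phi^2 is Q' phi^2, and Q' = -2t - 1/(2t^3) is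
  negative.\<close>

lemma laguerre_energy_antimono:
  assumes "0 < s" "s \<le> t"
  shows "laguerre_energy n t \<le> laguerre_energy n s"
proof (rule DERIV_nonpos_imp_nonincreasing[OF assms(2)])
  fix x assume "s \<le> x" "x \<le> t"
  with assms have x: "x > 0" by auto
  let ?L = "laguerre n (x\<^sup>2)" and ?D = "laguerre_deriv n (x\<^sup>2)"
  have L: "((\<lambda>t. laguerre n (t\<^sup>2)) has_real_derivative ?D * (2 * x)) (at x)"
    by (rule DERIV_chain2[OF laguerre_has_deriv]) (auto intro!: derivative_eq_intros)
  have D: "((\<lambda>t. laguerre_deriv n (t\<^sup>2)) has_real_derivative
      (?D - (real n * ?L + ?D) / x\<^sup>2) * (2 * x)) (at x)"
    by (rule DERIV_chain2[OF laguerre_deriv_has_deriv]) (use x in \<open>auto intro!: derivative_eq_intros\<close>)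
  define r where "r = 1 / x"
  have r: "x * r = 1" using x by (simp add: r_def)
  define P where "P = (\<lambda>t. 4 * t ^ 3 * (laguerre_deriv n (t\<^sup>2))\<^sup>2
      + 2 * (t - 2 * t ^ 3) * laguerre n (t\<^sup>2) * laguerre_deriv n (t\<^sup>2)
      + ((4 * real n + 1) * t + 1 / (2 * t)) * (laguerre n (t\<^sup>2))\<^sup>2)"
  define D' where "D' = 2 * x * ?D - 2 * (real n * ?L + ?D) * r"
  have D: "((\<lambda>t. laguerre_deriv n (t\<^sup>2)) has_real_derivative D') (at x)"
    by (rule DERIV_cong[OF D]) (use x in \<open>simp add: D'_def r_def field_simps power2_eq_square\<close>)
  have R: "((\<lambda>t. 1 / (2 * t)) has_real_derivative - (r\<^sup>2 / 2)) (at x)"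
    by (rule derivative_eq_intros refl | use x in \<open>simp add: r_def power2_eq_square\<close>)+
  have P: "(P has_real_derivative 12 * x\<^sup>2 * ?D\<^sup>2 + 8 * x ^ 3 * ?D * D'
      + 2 * (1 - 6 * x\<^sup>2) * ?L * ?D + 2 * (x - 2 * x ^ 3) * (?D * (2 * x)) * ?D + 2 * (x - 2 * x ^ 3) * ?L * D'
      + ((4 * real n + 1) - r\<^sup>2 / 2) * ?L\<^sup>2 + ((4 * real n + 1) * x + r / 2) * (2 * ?L * (?D * (2 * x)))) (at x)"
    (is "(P has_real_derivative ?P') (at x)")
    unfolding P_def
    by (rule derivative_eq_intros L D R refl)+
       (simp add: r_def algebra_simps power2_eq_square power3_eq_cube)
  have "((\<lambda>t. exp (- t\<^sup>2) * P t) has_real_derivative exp (- x\<^sup>2) * (?P' - 2 * x * P x)) (at x)"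
    by (rule derivative_eq_intros P refl)+ (simp add: algebra_simps)
  moreover have "P x = 4 * x ^ 3 * ?D\<^sup>2 + 2 * (x - 2 * x ^ 3) * ?L * ?D + ((4 * real n + 1) * x + r / 2) * ?L\<^sup>2"
    by (simp add: P_def r_def)
  then have "?P' - 2 * x * P x = - (2 * x\<^sup>2 + r\<^sup>2 / 2) * ?L\<^sup>2"
    using r unfolding D'_def by algebra
  moreover have "laguerre_energy n = (\<lambda>t. exp (- t\<^sup>2) * P t)"
    by (auto simp: laguerre_energy_def P_def)
  ultimately have "(laguerre_energy n has_real_derivative exp (- x\<^sup>2) * (- (2 * x\<^sup>2 + r\<^sup>2 / 2) * ?L\<^sup>2)) (at x)"
    by simp
  moreover have "0 \<le> exp (- x\<^sup>2) * ((2 * x\<^sup>2 + r\<^sup>2 / 2) * ?L\<^sup>2)"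
    by (intro mult_nonneg_nonneg add_nonneg_nonneg) auto
  then have "exp (- x\<^sup>2) * (- (2 * x\<^sup>2 + r\<^sup>2 / 2) * ?L\<^sup>2) \<le> 0"
    by (simp only: mult_minus_left mult_minus_right neg_le_0_iff_le)
  ultimately show "\<exists>y. (laguerre_energy n has_real_derivative y) (at x) \<and> y \<le> 0" by blast
qed

section \<open>Size of the Laguerre polynomials\<close>

text \<open>The two summands are phi'^2 and Q phi^2. Where Q is nonnegative each of them is bounded
  by the energy, which is how bounds on L_n and L_n' are read off.\<close>

lemma laguerre_energy_sum_squares:
  assumes "t > 0"
  shows "laguerre_energy n t = exp (- t\<^sup>2) *
    (t * (2 * t * laguerre_deriv n (t\<^sup>2) + (1 - 2 * t\<^sup>2) / (2 * t) * laguerre n (t\<^sup>2))\<^sup>2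
     + t * (4 * real n + 2 - t\<^sup>2 + 1 / (4 * t\<^sup>2)) * (laguerre n (t\<^sup>2))\<^sup>2)"
proof -
  define r where "r = 1 / t"
  have r: "t * r = 1" using assms by (simp add: r_def)
  have *: "1 / (2 * t) = r / 2" "(1 - 2 * t\<^sup>2) / (2 * t) = (1 - 2 * t\<^sup>2) * r / 2" "1 / (4 * t\<^sup>2) = r\<^sup>2 / 4"
    by (simp_all add: r_def power2_eq_square)
  define c where "c = (1 - 2 * t\<^sup>2) * r / 2"
  have h: "t * c = 1 / 2 - t\<^sup>2" "t * c\<^sup>2 = r / 4 - t + t ^ 3" "t * r\<^sup>2 = r"
    using assms by (simp_all add: c_def r_def field_simps power2_eq_square power3_eq_cube)
  have "4 * t ^ 3 * d\<^sup>2 + 2 * (t - 2 * t ^ 3) * l * d + ((4 * m + 1) * t + r / 2) * l\<^sup>2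
     = t * (2 * t * d + c * l)\<^sup>2 + t * (4 * m + 2 - t\<^sup>2 + r\<^sup>2 / 4) * l\<^sup>2" for d l m :: real
  proof -
    have "t * (2 * t * d + c * l)\<^sup>2 + t * (4 * m + 2 - t\<^sup>2 + r\<^sup>2 / 4) * l\<^sup>2
      = 4 * t ^ 3 * d\<^sup>2 + 4 * t * (t * c) * l * d + (t * c\<^sup>2) * l\<^sup>2
        + (4 * m * t + 2 * t - t ^ 3 + (t * r\<^sup>2) / 4) * l\<^sup>2"
      by (simp add: algebra_simps power2_eq_square power3_eq_cube)
    also have "\<dots> = 4 * t ^ 3 * d\<^sup>2 + 2 * (t - 2 * t ^ 3) * l * d + ((4 * m + 1) * t + r / 2) * l\<^sup>2"
      unfolding h by (simp add: algebra_simps power2_eq_square power3_eq_cube)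
    finally show ?thesis ..
  qed
  then show ?thesis
    unfolding laguerre_energy_def * c_def[symmetric] by simp
qed

text \<open>Monotonicity reduces the claim to s = (2n)^(-1/2). There
  \<open>laguerre_energy_near_0\<close> is still available and gives L_n^2 <= 1 and L_n'^2 <= 2
  n^2.\<close>

lemma laguerre_energy_le:
  assumes n: "n > 0" and t: "1 / (2 * real n) \<le> t\<^sup>2" "t > 0"
  shows "laguerre_energy n t \<le> 13 * sqrt n"
proof -
  define s where "s = sqrt (1 / (2 * real n))"
  have s: "s > 0" "s\<^sup>2 = 1 / (2 * real n)"
    using n by (simp_all add: s_def)
  define a b where "a = laguerre n (s\<^sup>2)" and "b = laguerre_deriv n (s\<^sup>2)"
  have ab: "a\<^sup>2 + b\<^sup>2 / (2 * (real n)\<^sup>2) \<le> 1"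
    using laguerre_energy_near_0[OF n, of "s\<^sup>2"] n s
    by (simp add: a_def b_def power2_eq_square)
  then have a: "a\<^sup>2 \<le> 1"
    by (rule order_trans[rotated]) simp
  have "b\<^sup>2 / (2 * (real n)\<^sup>2) \<le> 1"
    by (rule order_trans[rotated, OF ab]) simp
  then have b: "b\<^sup>2 \<le> 2 * (real n)\<^sup>2"
    using n by (simp add: field_simps)
  have "2 * (1 - 2 * s\<^sup>2) * a * b \<le> \<bar>2 * (1 - 2 * s\<^sup>2) * a * b\<bar>"
    by simp
  also have "\<dots> = \<bar>1 - 2 * s\<^sup>2\<bar> * (2 * \<bar>a\<bar> * \<bar>b\<bar>)"
    by (simp only: abs_mult abs_numeral mult_ac)
  also have "\<dots> \<le> 1 * (2 * \<bar>a\<bar> * \<bar>b\<bar>)"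
    using n by (intro mult_right_mono) (auto simp: s field_simps)
  \<comment> \<open>The weights in this arithmetic-geometric mean inequality reflect that b may be
    of order n while a is of order 1.\<close>
  also have "\<dots> \<le> real n * a\<^sup>2 + b\<^sup>2 / real n"
  proof -
    have "0 \<le> (real n * \<bar>a\<bar> - \<bar>b\<bar>)\<^sup>2 / real n" by simp
    also have "\<dots> = real n * a\<^sup>2 + b\<^sup>2 / real n - 2 * \<bar>a\<bar> * \<bar>b\<bar>"
      using n by (simp add: power2_diff power_mult_distrib diff_divide_distrib add_divide_distrib)
         (simp add: power2_eq_square)
    finally show ?thesis by simp
  qed
  also have "\<dots> \<le> real n * 1 + 2 * real n"
    using a b n by (intro add_mono mult_left_mono) (auto simp: field_simps power2_eq_square)
  finally have 1: "2 * (1 - 2 * s\<^sup>2) * a * b \<le> 3 * real n" by simp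
  have 2: "4 * s\<^sup>2 * b\<^sup>2 \<le> 4 * real n"
    unfolding s using b n by (simp add: field_simps power2_eq_square)
  \<comment> \<open>The extra \<open>real n\<close> is the term 1/(2s) of the energy, which equals s
    n. The three bounds add up to 12 n + 1, hence to at most 13 n.\<close>
  have 3: "(4 * real n + 1 + real n) * a\<^sup>2 \<le> (4 * real n + 1 + real n) * 1"
    using a by (intro mult_left_mono) auto
  have "1 \<le> real n" using n by simp
  then have 4: "4 * s\<^sup>2 * b\<^sup>2 + 2 * (1 - 2 * s\<^sup>2) * a * b + (4 * real n + 1 + real n) * a\<^sup>2 \<le> 13 * real n"
    by (intro order_trans[OF add_mono[OF add_mono[OF 2 1] 3]]) simp
  have sn: "1 / (2 * s) = s * real n"
    using s n by (simp add: field_simps power2_eq_square)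
  have "laguerre_energy n t \<le> laguerre_energy n s"
    using s t by (intro laguerre_energy_antimono) (auto simp: s_def intro: real_le_lsqrt)
  also have "laguerre_energy n s = exp (- s\<^sup>2) * (s * (4 * s\<^sup>2 * b\<^sup>2 + 2 * (1 - 2 * s\<^sup>2) * a * b
      + (4 * real n + 1 + real n) * a\<^sup>2))"
    unfolding laguerre_energy_def a_def[symmetric] b_def[symmetric] sn
    by (simp add: algebra_simps power2_eq_square power3_eq_cube)
  also have "\<dots> \<le> exp (- s\<^sup>2) * (s * (13 * real n))"
    using 4 s by (intro mult_left_mono) auto
  also have "\<dots> \<le> 1 * (s * (13 * real n))"
    using s n by (intro mult_right_mono) auto
  also have "s \<le> sqrt (1 / real n)"
    unfolding s_def using n by (intro real_sqrt_le_mono) (simp add: field_simps)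
  then have "s \<le> 1 / sqrt n"
    by (simp add: real_sqrt_divide)
  then have "1 * (s * (13 * real n)) \<le> 1 / sqrt n * (13 * real n)"
    using n by (simp only: mult_1) (intro mult_right_mono; simp)
  also have "\<dots> = 13 * sqrt n"
    using n by (simp add: field_simps)
  finally show ?thesis .
qed

text \<open>A crude bound for the range where Q may turn negative. Termwise, v^k / k! <= 2^k exp
  (v/2); the binomial theorem gives 3^n exp (v/2); finally 3 <= exp (9/8) and n <= v/3. The rate 7/8
  is below 1, so the weight e^-v still dominates.\<close>

lemma abs_laguerre_le_large:
  assumes "3 * real n \<le> v"
  shows "\<bar>laguerre n v\<bar> \<le> exp (7 / 8 * v)"
proof -
  have v: "0 \<le> v" using assms by (rule order_trans[rotated]) simp
  have *: "(v / 2) ^ k / fact k \<le> exp (v / 2)" for k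
  proof -
    have sums: "(\<lambda>i. (v / 2) ^ i /\<^sub>R fact i) sums exp (v / 2)"
      by (rule exp_converges)
    have "sum (\<lambda>i. (v / 2) ^ i /\<^sub>R fact i) {k} \<le> (\<Sum>i. (v / 2) ^ i /\<^sub>R fact i)"
      using v by (intro sum_le_suminf sums_summable[OF sums]) auto
    also have "\<dots> = exp (v / 2)"
      using sums by (rule sums_unique[symmetric])
    finally show ?thesis
      by (simp only: sum.insert finite.emptyI empty_iff not_False_eq_True sum.empty)
         (simp only: real_scaleR_def divide_inverse mult_ac add_0_right)
  qed
  have "\<bar>laguerre n v\<bar> \<le> (\<Sum>k=0..n. \<bar>real (n choose k) * (-1) ^ k / fact k * v ^ k\<bar>)"
    unfolding laguerre_def by (rule sum_abs)
  also have "\<dots> = (\<Sum>k=0..n. real (n choose k) * 2 ^ k * ((v / 2) ^ k / fact k))"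
    using v by (intro sum.cong refl) (simp add: abs_mult power_abs power_divide)
  also have "\<dots> \<le> (\<Sum>k=0..n. real (n choose k) * 2 ^ k * exp (v / 2))"
    by (intro sum_mono mult_left_mono *) auto
  also have "\<dots> = exp (v / 2) * 3 ^ n"
    using binomial_ring[of "2 :: real" 1 n]
    by (simp add: sum_distrib_left mult_ac atLeast0AtMost)
  also have "(3::real) ^ n \<le> exp (9 / 8) ^ n"
  proof (rule power_mono)
    \<comment> \<open>The quadratic Taylor polynomial of exp at 3/8 is about 1.445, whose cube just
      exceeds 3.\<close>
    have "(3::real) \<le> (1 + 3 / 8 + (3 / 8)\<^sup>2 / 2) ^ 3"
      by (simp add: power2_eq_square power3_eq_cube)
    also have "\<dots> \<le> exp (3 / 8) ^ 3"
      using exp_lower_Taylor_quadratic[of "3 / 8"] by (intro power_mono) auto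
    also have "\<dots> = exp (9 / 8 :: real)"
      using exp_of_nat_mult[of 3 "3 / 8 :: real"] by simp
    finally show "3 \<le> exp (9 / 8 :: real)" .
  qed simp
  also have "exp (9 / 8 :: real) ^ n = exp (9 / 8 * real n)"
    using exp_of_nat_mult[of n "9 / 8 :: real"] by (simp only: mult.commute)
  also have "exp (v / 2) * exp (9 / 8 * real n) \<le> exp (v / 2) * exp (3 / 8 * v)"
    using assms by (intro mult_left_mono) auto
  also have "\<dots> = exp (7 / 8 * v)"
    by (simp flip: exp_add)
  finally show ?thesis by simp
qed

text \<open>Three ranges: the energy near 0, the energy phi'^2 + Q phi^2 up to 3n, and the crude
  bound beyond. The exponent 15/8 leaves room for polynomial factors next to exp v in the middle
  range and next to exp (7v/4) in the outer one.\<close>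

lemma laguerre_bounds:
  assumes n: "n > 0" and v: "v > 0"
  shows laguerre_square_le: "(laguerre n v)\<^sup>2 * sqrt (real n * v) \<le> 100 * exp (15 / 8 * v)" (is ?A)
    and laguerre_deriv_square_le: "(v * laguerre_deriv n v)\<^sup>2 \<le> 100 * sqrt n * exp (15 / 8 * v)" (is ?B)
proof -
  have n1: "1 \<le> sqrt n" using n by simp
  have e1: "1 \<le> exp (15 / 8 * v)" using v by simp
  consider "v \<le> 1 / (2 * real n)" | "1 / (2 * real n) \<le> v" "v \<le> 3 * real n" | "3 * real n \<le> v"
    by linarith
  then have "?A \<and> ?B"
  proof cases
    case 1
    have nv: "real n * v \<le> 1"
      using 1 n by (simp add: field_simps)
    have "v \<le> 1 / 2"
      using 1 by (rule order_trans) (use n in \<open>simp add: field_simps\<close>)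
    note * = laguerre_energy_near_0[OF n less_imp_le[OF v] this]
    have "(laguerre n v)\<^sup>2 \<le> 1"
      by (rule order_trans[rotated, OF *]) (use v in simp)
    then have "(laguerre n v)\<^sup>2 * sqrt (real n * v) \<le> 1 * 1"
      using nv v by (intro mult_mono) auto
    moreover have "v / real n * (laguerre_deriv n v)\<^sup>2 \<le> 1"
      by (rule order_trans[rotated, OF *]) simp
    then have "v * real n * (v / real n * (laguerre_deriv n v)\<^sup>2) \<le> 1 * 1"
      using nv v by (intro mult_mono) (auto simp: mult.commute)
    then have "(v * laguerre_deriv n v)\<^sup>2 \<le> 1"
      using n by (simp add: power2_eq_square mult_ac)
    moreover have "1 * 1 \<le> sqrt n * exp (15 / 8 * v)"
      using n1 e1 by (intro mult_mono) auto
    ultimately show ?thesis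
      using e1 by (intro conjI; linarith)
  next
    case 2
    define t where "t = sqrt v"
    have t: "t > 0" "t\<^sup>2 = v" using v by (auto simp: t_def)
    define X where "X = 2 * t * laguerre_deriv n v + (1 - 2 * v) / (2 * t) * laguerre n v"
    have W: "exp (- v) * (t * X\<^sup>2 + t * (4 * real n + 2 - v + 1 / (4 * v)) * (laguerre n v)\<^sup>2) \<le> 13 * sqrt n"
      using laguerre_energy_le[OF n, of t] laguerre_energy_sum_squares[of t n] t 2
      by (simp add: X_def)
    have W: "t * X\<^sup>2 + t * (4 * real n + 2 - v + 1 / (4 * v)) * (laguerre n v)\<^sup>2 \<le> 13 * sqrt n * exp v"
    proof -
      have "exp v * (exp (- v) * (t * X\<^sup>2 + t * (4 * real n + 2 - v + 1 / (4 * v)) * (laguerre n v)\<^sup>2))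
          \<le> exp v * (13 * sqrt n)"
        by (rule mult_left_mono[OF W]) simp
      then show ?thesis
        by (simp add: mult.assoc[symmetric] exp_minus_inverse) (simp add: mult_ac)
    qed
    \<comment> \<open>In this range v <= 3n, so Q is at least n and the energy controls n t
      L_n^2.\<close>
    have "real n \<le> 4 * real n + 2 - v + 1 / (4 * v)"
      using 2 v by (simp add: add_increasing2)
    then have "t * real n * (laguerre n v)\<^sup>2 \<le> t * (4 * real n + 2 - v + 1 / (4 * v)) * (laguerre n v)\<^sup>2"
      using t by (intro mult_right_mono mult_left_mono) auto
    moreover have "0 \<le> t * X\<^sup>2"
      using t by simp
    ultimately have tL: "t * real n * (laguerre n v)\<^sup>2 \<le> 13 * sqrt n * exp v"
      using W by linarith
    have "sqrt n * ((laguerre n v)\<^sup>2 * sqrt (real n * v)) = t * (sqrt n * sqrt n) * (laguerre n v)\<^sup>2"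
      by (simp only: t_def real_sqrt_mult mult_ac)
    also have "\<dots> = t * real n * (laguerre n v)\<^sup>2" by simp
    also note tL
    also have "13 * sqrt n * exp v = sqrt n * (13 * exp v)" by simp
    finally have "sqrt n * ((laguerre n v)\<^sup>2 * sqrt (real n * v)) \<le> sqrt n * (13 * exp v)" .
    then have A: "(laguerre n v)\<^sup>2 * sqrt (real n * v) \<le> 13 * exp v"
      by (rule mult_left_le_imp_le) (use n in simp)
    also have "\<dots> \<le> 100 * exp (15 / 8 * v)"
      using v by (intro mult_mono) auto
    finally have ?A .
    have "0 \<le> t * (4 * real n + 2 - v + 1 / (4 * v)) * (laguerre n v)\<^sup>2"
      using t 2 v by (intro mult_nonneg_nonneg) auto
    then have X: "t * X\<^sup>2 \<le> 13 * sqrt n * exp v"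
      using W by linarith
    \<comment> \<open>Since n v >= 1/2, the first bound also controls L_n^2 without the factor sqrt
      (n v).\<close>
    have "1 / 2 \<le> sqrt (real n * v)"
      using 2 n by (intro real_le_rsqrt) (auto simp: field_simps power2_eq_square)
    then have "(laguerre n v)\<^sup>2 * (1 / 2) \<le> (laguerre n v)\<^sup>2 * sqrt (real n * v)"
      by (intro mult_left_mono) auto
    then have L: "(laguerre n v)\<^sup>2 \<le> 26 * exp v"
      using A by linarith
    \<comment> \<open>Solving the definition of \<open>X\<close> for the derivative gives 2 v L_n' =
      t X - (1 - 2v)/2 L_n, so bounds on \<open>X\<close> and L_n suffice.\<close>
    have "(2 * (v * laguerre_deriv n v))\<^sup>2 = (t * X - (1 - 2 * v) / 2 * laguerre n v)\<^sup>2"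
    proof -
      have "t * X = 2 * (t\<^sup>2 * laguerre_deriv n v) + (1 - 2 * v) / 2 * laguerre n v"
        unfolding X_def distrib_left using t(1) by (simp add: power2_eq_square)
      then show ?thesis by (simp add: t)
    qed
    also have "\<dots> \<le> 2 * (t * X)\<^sup>2 + 2 * ((1 - 2 * v) / 2 * laguerre n v)\<^sup>2"
      using sum_squares_bound zero_le_power2[of "t * X + (1 - 2 * v) / 2 * laguerre n v"]
      unfolding power2_diff power2_sum by linarith
    also have "\<dots> = 2 * t * (t * X\<^sup>2) + (1 - 2 * v)\<^sup>2 / 2 * (laguerre n v)\<^sup>2"
      by (simp add: power_mult_distrib power_divide) (simp add: power2_eq_square)
    also have "\<dots> \<le> 2 * t * (13 * sqrt n * exp v) + (1 - 2 * v)\<^sup>2 / 2 * (26 * exp v)"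
      using X L t by (intro add_mono mult_left_mono) auto
    also have "\<dots> \<le> 2 * t * (13 * sqrt n * exp v) + (1 - 2 * v)\<^sup>2 / 2 * (26 * exp v * sqrt n)"
      using n1 t by (intro add_mono mult_left_mono) auto
    also have "\<dots> = sqrt n * exp v * (26 * t + 13 * (1 - 2 * v)\<^sup>2)"
      by (simp add: algebra_simps)
    also have "\<dots> \<le> sqrt n * exp v * (400 * exp (7 / 8 * v))"
    proof (intro mult_left_mono)
      have "1 + 7 / 8 * v + 49 / 128 * v\<^sup>2 \<le> exp (7 / 8 * v)"
        using v exp_lower_Taylor_quadratic[of "7 / 8 * v"] by (simp add: power_mult_distrib power_divide)
      moreover have "t \<le> 1 + v"
        using zero_le_power2[of "t - 1"] t unfolding power2_diff by simp
      moreover have "(1 - 2 * v)\<^sup>2 = 1 - 4 * v + 4 * v\<^sup>2"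
        by (simp add: power2_eq_square algebra_simps)
      ultimately show "26 * t + 13 * (1 - 2 * v)\<^sup>2 \<le> 400 * exp (7 / 8 * v)"
        using v zero_le_power2[of v] by linarith
    qed auto
    also have "\<dots> = 400 * sqrt n * exp (15 / 8 * v)"
      by (simp flip: exp_add)
    finally have ?B
      by (simp add: power_mult_distrib)
    with \<open>?A\<close> show ?thesis ..
  next
    case 3
    have nv: "real n \<le> v" using 3 v by simp
    have quad: "1 + v / 8 + (v / 8)\<^sup>2 / 2 \<le> exp (v / 8)"
      using v exp_lower_Taylor_quadratic[of "v / 8"] by simp
    have L: "(laguerre m v)\<^sup>2 \<le> exp (7 / 4 * v)" if "m \<le> n" for m
    proof -
      have "\<bar>laguerre m v\<bar> \<le> exp (7 / 8 * v)"
        using that 3 by (intro abs_laguerre_le_large) auto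
      then have "\<bar>laguerre m v\<bar>\<^sup>2 \<le> exp (7 / 8 * v) ^ 2"
        by (intro power_mono) auto
      then show ?thesis by (simp flip: exp_double)
    qed
    have "sqrt (real n * v) \<le> v"
      using nv v by (intro real_le_lsqrt) (auto simp: power2_eq_square)
    also have "v \<le> 8 * exp (v / 8)"
      using quad zero_le_power2[of "v / 8"] by linarith
    finally have "(laguerre n v)\<^sup>2 * sqrt (real n * v) \<le> exp (7 / 4 * v) * (8 * exp (v / 8))"
      using L[of n] v by (intro mult_mono) auto
    also have "\<dots> = 8 * exp (15 / 8 * v)"
      by (simp flip: exp_add)
    also have "\<dots> \<le> 100 * exp (15 / 8 * v)" by simp
    finally have ?A .
    obtain m where m: "n = Suc m" using n by (cases n) auto
    \<comment> \<open>Here v L_n' = n (L_n - L_{n-1}), and the crude bound applies to both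
      polynomials.\<close>
    have "(v * laguerre_deriv n v)\<^sup>2 = (real n)\<^sup>2 * (laguerre n v - laguerre m v)\<^sup>2"
      unfolding m laguerre_deriv_Suc_mult by (simp only: power_mult_distrib)
    also have "\<dots> \<le> (real n)\<^sup>2 * (2 * (laguerre n v)\<^sup>2 + 2 * (laguerre m v)\<^sup>2)"
      using zero_le_power2[of "laguerre n v + laguerre m v"]
      by (intro mult_left_mono) (auto simp: power2_diff power2_sum)
    also have "\<dots> \<le> (v / 3)\<^sup>2 * (2 * exp (7 / 4 * v) + 2 * exp (7 / 4 * v))"
      using 3 v m by (intro mult_mono power_mono add_mono L) auto
    also have "\<dots> = (v\<^sup>2 * (4 / 9)) * exp (7 / 4 * v)"
      by (simp add: power_divide)
    also have "\<dots> \<le> (100 * exp (v / 8)) * exp (7 / 4 * v)"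
    proof (intro mult_right_mono)
      have "v\<^sup>2 / 128 = (v / 8)\<^sup>2 / 2"
        by (simp add: power_divide)
      with quad v zero_le_power2[of v] show "v\<^sup>2 * (4 / 9) \<le> 100 * exp (v / 8)"
        by linarith
    qed simp
    also have "\<dots> = 100 * 1 * exp (15 / 8 * v)"
      by (simp flip: exp_add)
    also have "\<dots> \<le> 100 * sqrt n * exp (15 / 8 * v)"
      using n1 by (intro mult_mono) auto
    finally have ?B .
    with \<open>?A\<close> show ?thesis ..
  qed
  then show ?A ?B by auto
qed

lemma powr_quarter_squared:
  assumes "x > 0"
  shows "(x powr (1/4))\<^sup>2 = sqrt x" "(x powr (-1/4))\<^sup>2 = 1 / sqrt x"
  using assms by (simp_all add: power2_eq_square powr_minus_divide powr_half_sqrt flip: powr_add)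

lemma abs_laguerre_le:
  assumes "n > 0" "v > 0"
  shows "\<bar>laguerre n v\<bar> \<le> 10 * real n powr (-1/4) * (v powr (-1/4) * exp (15 / 16 * v))"
proof (rule power2_le_imp_le)
  have eq: "(10 * real n powr (-1/4) * (v powr (-1/4) * exp (15 / 16 * v)))\<^sup>2
      = 100 * exp (15 / 8 * v) / sqrt (real n * v)"
    unfolding power_mult_distrib powr_quarter_squared(2)[OF assms(2)]
      powr_quarter_squared(2)[OF of_nat_0_less_iff[THEN iffD2, OF assms(1)]]
    by (simp add: real_sqrt_mult flip: exp_double)
  show "\<bar>laguerre n v\<bar>\<^sup>2 \<le> (10 * real n powr (-1/4) * (v powr (-1/4) * exp (15 / 16 * v)))\<^sup>2"
    unfolding eq using laguerre_square_le[OF assms] assms by (simp add: pos_le_divide_eq)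
qed (use assms in auto)

lemma abs_laguerre_deriv_le:
  assumes "n > 0" "v > 0"
  shows "\<bar>v * laguerre_deriv n v\<bar> \<le> 10 * real n powr (1/4) * exp (15 / 16 * v)"
proof (rule power2_le_imp_le)
  have "(10 * real n powr (1/4) * exp (15 / 16 * v))\<^sup>2 = 100 * sqrt n * exp (15 / 8 * v)"
    unfolding power_mult_distrib using assms
    by (simp add: powr_quarter_squared flip: exp_double)
  then show "\<bar>v * laguerre_deriv n v\<bar>\<^sup>2 \<le> (10 * real n powr (1/4) * exp (15 / 16 * v))\<^sup>2"
    using laguerre_deriv_square_le[OF assms] assms by simp
qed (use assms in auto)

section \<open>A Riemann--Lebesgue lemma\<close>

text \<open>The bound on h is asked only where f is nonzero, so a function controlled on (0,
  infinity) can be integrated against a weight supported there.\<close>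

lemma integrable_mult_bounded:
  fixes f h :: "real \<Rightarrow> real"
  assumes f: "integrable lborel f" and h [measurable]: "h \<in> borel_measurable borel"
    and B: "\<And>x. f x \<noteq> 0 \<Longrightarrow> \<bar>h x\<bar> \<le> B"
  shows "integrable lborel (\<lambda>x. h x * f x)"
proof (rule Bochner_Integration.integrable_bound)
  show "integrable lborel (\<lambda>x. B * f x)"
    using f by simp
  show "(\<lambda>x. h x * f x) \<in> borel_measurable lborel"
    using borel_measurable_integrable[OF f] by measurable
  show "AE x in lborel. norm (h x * f x) \<le> norm (B * f x)"
  proof (intro AE_I2)
    fix x
    show "norm (h x * f x) \<le> norm (B * f x)"
      using B[of x] by (cases "f x = 0") (auto simp: abs_mult intro!: mult_right_mono)
  qed
qed

text \<open>Replacing g by U_i costs at most the integral of |g - U_i| w. This error does not depend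
  on n and tends to 0 in i by dominated convergence.\<close>

lemma Riemann_Lebesgue_bounded_limit:
  fixes M :: "nat \<Rightarrow> real \<Rightarrow> real"
  assumes w: "integrable lborel w" and M [measurable]: "\<And>n. M n \<in> borel_measurable borel"
    and Mw: "\<And>n x. \<bar>M n x\<bar> \<le> w x"
    and U [measurable]: "\<And>i. U i \<in> borel_measurable borel" and UB: "\<And>i x. \<bar>U i x\<bar> \<le> B"
    and U0: "\<And>i. (\<lambda>n. \<integral>x. U i x * M n x \<partial>lborel) \<longlonglongrightarrow> 0"
    and g [measurable]: "g \<in> borel_measurable borel" and Ug: "\<And>x. (\<lambda>i. U i x) \<longlonglongrightarrow> g x"
  shows "(\<lambda>n. \<integral>x. g x * M n x \<partial>lborel) \<longlonglongrightarrow> 0"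
proof (rule LIMSEQ_I)
  fix e :: real assume e: "e > 0"
  note w' [measurable] = borel_measurable_integrable[OF w]
  have gB: "\<bar>g x\<bar> \<le> B" for x
    by (rule tendsto_upperbound[OF tendsto_rabs[OF Ug]]) (auto simp: UB)
  have gUB: "\<bar>g x - U i x\<bar> \<le> 2 * B" for i x
    using gB[of x] UB[of i x] by linarith
  have w0: "0 \<le> w x" for x
    using Mw[of 0 x] by linarith
  have iM: "integrable lborel (M n)" for n
    by (rule Bochner_Integration.integrable_bound[OF w]) (use Mw w0 in auto)
  have "(\<lambda>i. \<integral>x. \<bar>g x - U i x\<bar> * w x \<partial>lborel) \<longlonglongrightarrow> integral\<^sup>L lborel (\<lambda>x::real. 0)"
  proof (rule integral_dominated_convergence)
    show "integrable lborel (\<lambda>x. 2 * B * w x)"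
      using w by simp
    show "AE x in lborel. (\<lambda>i. \<bar>g x - U i x\<bar> * w x) \<longlonglongrightarrow> 0"
    proof (intro AE_I2)
      fix x
      have "(\<lambda>i. \<bar>g x - U i x\<bar> * w x) \<longlonglongrightarrow> \<bar>g x - g x\<bar> * w x"
        by (intro tendsto_intros Ug)
      then show "(\<lambda>i. \<bar>g x - U i x\<bar> * w x) \<longlonglongrightarrow> 0" by simp
    qed
    show "AE x in lborel. norm (\<bar>g x - U i x\<bar> * w x) \<le> 2 * B * w x" for i
    proof (intro AE_I2)
      fix x
      show "norm (\<bar>g x - U i x\<bar> * w x) \<le> 2 * B * w x"
        using w0[of x] gUB[of x i] by (simp add: abs_mult mult_right_mono)
    qed
  qed auto
  then obtain i where i: "\<bar>\<integral>x. \<bar>g x - U i x\<bar> * w x \<partial>lborel\<bar> < e / 2"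
    using LIMSEQ_D[of _ _ "e / 2"] e by fastforce
  obtain N where N: "\<And>n. n \<ge> N \<Longrightarrow> \<bar>\<integral>x. U i x * M n x \<partial>lborel\<bar> < e / 2"
    using LIMSEQ_D[OF U0[of i], of "e / 2"] e by fastforce
  have "\<bar>\<integral>x. g x * M n x \<partial>lborel\<bar> < e" if n: "n \<ge> N" for n
  proof -
    have i1: "integrable lborel (\<lambda>x. U i x * M n x)"
      by (rule integrable_mult_bounded[OF iM]) (use UB in auto)
    have i2: "integrable lborel (\<lambda>x. (g x - U i x) * M n x)"
      by (rule integrable_mult_bounded[OF iM, where B = "2 * B"])
         (use gUB in auto)
    have i3: "integrable lborel (\<lambda>x. \<bar>g x - U i x\<bar> * w x)"
      by (rule integrable_mult_bounded[OF w, where B = "2 * B"])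
         (use gUB in auto)
    have "(\<integral>x. g x * M n x \<partial>lborel) = (\<integral>x. U i x * M n x + (g x - U i x) * M n x \<partial>lborel)"
      by (intro Bochner_Integration.integral_cong) (auto simp: algebra_simps)
    also have "\<dots> = (\<integral>x. U i x * M n x \<partial>lborel) + (\<integral>x. (g x - U i x) * M n x \<partial>lborel)"
      using i1 i2 by simp
    finally have "\<bar>\<integral>x. g x * M n x \<partial>lborel\<bar>
        \<le> \<bar>\<integral>x. U i x * M n x \<partial>lborel\<bar> + \<bar>\<integral>x. (g x - U i x) * M n x \<partial>lborel\<bar>"
      by simp
    also have "\<bar>\<integral>x. (g x - U i x) * M n x \<partial>lborel\<bar> \<le> (\<integral>x. \<bar>(g x - U i x) * M n x\<bar> \<partial>lborel)"
      by (rule integral_abs_bound)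
    also have "\<dots> \<le> (\<integral>x. \<bar>g x - U i x\<bar> * w x \<partial>lborel)"
      by (intro integral_mono integrable_abs i2 i3) (auto simp: abs_mult intro!: mult_left_mono Mw)
    finally show ?thesis
      using i N[OF n] by linarith
  qed
  then show "\<exists>N. \<forall>n\<ge>N. norm ((\<integral>x. g x * M n x \<partial>lborel) - 0) < e"
    by auto
qed

text \<open>The claim passes from half-lines to Borel sets by Dynkin induction and then to bounded
  measurable functions by a monotone class argument. This covers difference quotients of {e^v},
  which have infinitely many jumps.\<close>

lemma Riemann_Lebesgue_bounded:
  fixes M :: "nat \<Rightarrow> real \<Rightarrow> real"
  assumes w: "integrable lborel w" and M [measurable]: "\<And>n. M n \<in> borel_measurable borel"
    and Mw: "\<And>n x. \<bar>M n x\<bar> \<le> w x"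
    and half: "\<And>d. (\<lambda>n. \<integral>x. indicator {..d} x * M n x \<partial>lborel) \<longlonglongrightarrow> 0"
    and total: "(\<lambda>n. \<integral>x. M n x \<partial>lborel) \<longlonglongrightarrow> 0"
    and g: "g \<in> borel_measurable borel" and gB: "\<And>x. \<bar>g x\<bar> \<le> B"
  shows "(\<lambda>n. \<integral>x. g x * M n x \<partial>lborel) \<longlonglongrightarrow> 0"
proof -
  define P where "P = (\<lambda>g. (\<lambda>n. \<integral>x. g x * M n x \<partial>lborel) \<longlonglongrightarrow> (0::real))"
  note w' [measurable] = borel_measurable_integrable[OF w]
  have w0: "0 \<le> w x" for x
    using Mw[of 0 x] by linarith
  have iM: "integrable lborel (M n)" for n
    by (rule Bochner_Integration.integrable_bound[OF w]) (use Mw w0 in auto)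
  note lim = Riemann_Lebesgue_bounded_limit[OF w M Mw]
  have P_lin: "P (\<lambda>x. a * f x + b * h x)" if "P f" "P h"
    and [measurable]: "f \<in> borel_measurable borel" "h \<in> borel_measurable borel"
    and B: "\<And>x. \<bar>f x\<bar> \<le> C" "\<And>x. \<bar>h x\<bar> \<le> D" for a b f h C D
  proof -
    have "integrable lborel (\<lambda>x. f x * M n x)" "integrable lborel (\<lambda>x. h x * M n x)" for n
      by (rule integrable_mult_bounded[OF iM]; use B in auto)+
    then have "(\<integral>x. (a * f x + b * h x) * M n x \<partial>lborel)
        = a * (\<integral>x. f x * M n x \<partial>lborel) + b * (\<integral>x. h x * M n x \<partial>lborel)" for n
      by (simp add: distrib_right mult.assoc)
    moreover have "(\<lambda>n. a * (\<integral>x. f x * M n x \<partial>lborel) + b * (\<integral>x. h x * M n x \<partial>lborel)) \<longlonglongrightarrow> a * 0 + b * 0"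
      by (intro tendsto_intros that(1,2)[unfolded P_def])
    ultimately show ?thesis by (simp add: P_def)
  qed
  \<comment> \<open>Half-lines form an intersection-stable generator. Complements use the assumption
    on the total integral; countable disjoint unions are bounded limits of finite ones.\<close>
  have P_set: "P (indicator A)" if "A \<in> sets borel" for A
  proof -
    have eq: "sets borel = sigma_sets UNIV (range (\<lambda>a. {..a::real}))"
      by (subst borel_eq_atMost) (rule sets_measure_of, auto)
    from that have A: "A \<in> sigma_sets UNIV (range (\<lambda>a. {..a::real}))"
      unfolding eq .
    have "Int_stable (range (\<lambda>a. {..a::real}))"
      by (auto simp: Int_stable_def)
    then show ?thesis
    proof (rule sigma_sets_induct_disjoint[where P = "\<lambda>A. P (indicator A)", OF _ _ A])
      fix A assume "A \<in> range (\<lambda>a. {..a::real})"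
      then show "P (indicator A)"
        using half by (auto simp: P_def)
    next
      fix A :: "real set" assume "A \<in> sigma_sets UNIV (range (\<lambda>a. {..a::real}))" and PA: "P (indicator A)"
      then have [measurable]: "A \<in> sets borel" using eq by simp
      have "P (\<lambda>x. 1 * (\<lambda>_. 1) x + (- 1) * indicator A x)"
        using total PA by (intro P_lin[where C = 1 and D = 1]) (auto simp: P_def indicator_def)
      moreover have "indicator (UNIV - A) = (\<lambda>x. 1 * (\<lambda>_. 1) x + (- 1) * indicator A x :: real)"
        by (auto simp: indicator_def)
      ultimately show "P (indicator (UNIV - A))" by simp
    next
      fix A :: "nat \<Rightarrow> real set"
      assume disj: "disjoint_family A" and "range A \<subseteq> sigma_sets UNIV (range (\<lambda>a. {..a::real}))"
        and PA: "\<And>i. P (indicator (A i))"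
      then have A [measurable]: "A i \<in> sets borel" for i using eq by auto
      have fin: "P (indicator (\<Union>j<i. A j))" for i
      proof (induction i)
        case (Suc i)
        have "P (\<lambda>x. 1 * indicator (\<Union>j<i. A j) x + 1 * indicator (A i) x)"
          by (intro P_lin[where C = 1 and D = 1] Suc PA) (auto simp: indicator_def)
        moreover have "indicator (\<Union>j<Suc i. A j) x
            = (1 * indicator (\<Union>j<i. A j) x + 1 * indicator (A i) x :: real)" for x
          using disjoint_family_onD[OF disj, of _ i] by (fastforce simp: indicator_def lessThan_Suc)
        ultimately show ?case by presburger
      qed (simp add: P_def)
      show "P (indicator (\<Union>i. A i))"
        unfolding P_def
      proof (rule lim[where U = "\<lambda>i. indicator (\<Union>j<i. A j)" and B = 1])
        fix x :: real
        show "(\<lambda>i. indicator (\<Union>j<i. A j) x :: real) \<longlonglongrightarrow> indicator (\<Union>i. A i) x"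
          by (rule LIMSEQ_indicator_UN)
      qed (use fin in \<open>auto simp: P_def indicator_def\<close>)
    qed (auto simp: P_def indicator_def)
  qed
  \<comment> \<open>Boundedness is a premise inside the induction claim, because the induction runs
    over all nonnegative measurable functions. Summands and increasing approximants inherit the
    bound.\<close>
  have P_nonneg: "(\<exists>B. \<forall>x. u x \<le> B) \<longrightarrow> P u" if "u \<in> borel_measurable borel" "\<And>x. 0 \<le> u x" for u
    using that
  proof (induction u rule: borel_measurable_induct_real)
    case (set A)
    then show ?case using P_set by simp
  next
    case (mult u c)
    show ?case
    \<comment> \<open>For c = 0 a bound on c u says nothing about u.\<close>
    proof (cases "c = 0")
      case True
      then show ?thesis by (simp add: P_def)
    next
      case False
      show ?thesis
      proof
        assume "\<exists>B. \<forall>x. c * u x \<le> B"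
        then obtain B where B: "\<And>x. c * u x \<le> B" by auto
        have uB: "u x \<le> B / c" for x
          using B[of x] mult(1) False by (simp add: field_simps)
        then have "P u" using mult by blast
        then have "P (\<lambda>x. c * u x + 0 * u x)"
          using mult uB by (intro P_lin[where C = "B / c" and D = "B / c"]) auto
        then show "P (\<lambda>x. c * u x)" by simp
      qed
    qed
  next
    case (add u v)
    show ?case
    proof
      assume "\<exists>B. \<forall>x. v x + u x \<le> B"
      then obtain B where B: "\<And>x. v x + u x \<le> B" by auto
      have uv: "u x \<le> B" "v x \<le> B" for x
        using B[of x] add(2)[of x] add(4)[of x] by linarith+
      then have "P u" "P v" using add by blast+
      then have "P (\<lambda>x. 1 * v x + 1 * u x)"
        using add uv by (intro P_lin[where C = B and D = B]) auto
      then show "P (\<lambda>x. v x + u x)" by simp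
    qed
  next
    case (seq U)
    show ?case
    proof
      assume "\<exists>B. \<forall>x. u x \<le> B"
      then obtain B where B: "\<And>x. u x \<le> B" by auto
      have UB: "U i x \<le> B" for i x
      proof -
        have "incseq (\<lambda>i. U i x)"
          using seq(3) by (auto simp: incseq_def le_fun_def)
        from incseq_le[OF this seq(4)] B[of x] show ?thesis
          by (auto intro: order_trans)
      qed
      then have PU: "P (U i)" for i
        by (intro seq.IH[rule_format] exI[of _ B] allI)
      show "P u"
        unfolding P_def
      proof (rule lim[where U = U and B = B])
        show "\<bar>U i x\<bar> \<le> B" for i x
          using seq(2) UB by simp
      qed (use seq(1,4) PU \<open>u \<in> borel_measurable borel\<close> in \<open>auto simp: P_def\<close>)
    qed
  qed
  have [measurable]: "g \<in> borel_measurable borel" by fact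
  have g_eq: "(\<lambda>x. 1 * max (g x) 0 + (- 1) * max (- g x) 0) = g"
    by (intro ext) (simp add: max_def)
  have "P (\<lambda>x. 1 * max (g x) 0 + (- 1) * max (- g x) 0)"
  proof (rule P_lin[where C = B and D = B])
    have "\<bar>max (g x) 0\<bar> \<le> B" "\<bar>max (- g x) 0\<bar> \<le> B" for x
      using gB[of x] by auto
    then show "P (\<lambda>x. max (g x) 0)" "P (\<lambda>x. max (- g x) 0)"
      "\<And>x. \<bar>max (g x) 0\<bar> \<le> B" "\<And>x. \<bar>max (- g x) 0\<bar> \<le> B"
      by (auto intro!: P_nonneg[rule_format] exI[of _ B] simp: abs_le_iff)
  qed auto
  then have "P g"
    by (simp only: g_eq)
  then show ?thesis by (simp add: P_def)
qed

section \<open>Integrals against the weight e^-v on the half-line\<close>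

definition exp_weight :: "real \<Rightarrow> real" where
  "exp_weight v = indicator {0<..} v * exp (- v)"

lemma exp_weight_measurable [measurable]: "exp_weight \<in> borel_measurable borel"
  unfolding exp_weight_def[abs_def] by measurable

lemma exp_weight_nonneg [simp]: "0 \<le> exp_weight v"
  by (simp add: exp_weight_def)

lemma integrable_powr_div_exp:
  assumes "s > (0::real)"
  shows "integrable lborel (\<lambda>t. indicator {0..} t * t powr (s - 1) / exp t)"
proof (rule integrableI_nonneg)
  show "(\<integral>\<^sup>+ t. ennreal (indicator {0..} t * t powr (s - 1) / exp t) \<partial>lborel) < \<infinity>"
    unfolding Gamma_conv_nn_integral_real[OF assms, symmetric] by simp
qed auto

text \<open>Negative exponents are included because the dominating functions below contain v^(-1/4)
  and v^(-1/2).\<close>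

lemma integrable_exp_weight_powr:
  assumes "s > (-1::real)"
  shows "integrable lborel (\<lambda>v. v powr s * exp_weight v)"
proof -
  have "(\<lambda>v. v powr s * exp_weight v) = (\<lambda>t. indicator {0..} t * t powr ((s + 1) - 1) / exp t)"
    by (intro ext) (auto simp: exp_weight_def exp_minus divide_inverse indicator_def)
  then show ?thesis
    using integrable_powr_div_exp[of "s + 1"] assms by simp
qed

lemma integrable_exp_weight_power: "integrable lborel (\<lambda>v. v ^ k * exp_weight v)"
proof -
  have "(\<lambda>v. v ^ k * exp_weight v) = (\<lambda>v. v powr real k * exp_weight v)"
    by (intro ext) (auto simp: exp_weight_def powr_realpow indicator_def)
  then show ?thesis
    using integrable_exp_weight_powr[of "real k"] by simp
qed

lemma laguerre_measurable [measurable]: "laguerre n \<in> borel_measurable borel"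
  unfolding laguerre_def[abs_def] by measurable

lemma laguerre_deriv_measurable [measurable]: "laguerre_deriv n \<in> borel_measurable borel"
  unfolding laguerre_deriv_def[abs_def] by measurable

lemma isCont_laguerre [continuous_intros]: "isCont (laguerre n) v"
  by (rule DERIV_isCont[OF laguerre_has_deriv])

lemma isCont_laguerre_deriv [continuous_intros]: "isCont (laguerre_deriv n) v"
  unfolding laguerre_deriv_def[abs_def] by (intro continuous_intros isCont_laguerre)

lemma integrable_laguerre_power: "integrable lborel (\<lambda>v. v ^ j * laguerre n v * exp_weight v)"
proof -
  have "(\<lambda>v. v ^ j * laguerre n v * exp_weight v)
      = (\<lambda>v. \<Sum>k=0..n. real (n choose k) * (-1) ^ k / fact k * (v ^ (k + j) * exp_weight v))"
    by (auto simp: laguerre_def sum_distrib_left sum_distrib_right power_add mult_ac intro!: sum.cong)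
  then show ?thesis
    using integrable_exp_weight_power by (auto intro!: Bochner_Integration.integrable_sum)
qed

lemma integrable_laguerre: "integrable lborel (\<lambda>v. laguerre n v * exp_weight v)"
  using integrable_laguerre_power[of 0 n] by simp

lemma integrable_laguerre_deriv_power: "integrable lborel (\<lambda>v. v ^ j * laguerre_deriv n v * exp_weight v)"
proof -
  have "(\<lambda>v. v ^ j * laguerre_deriv n v * exp_weight v)
      = (\<lambda>v. - (\<Sum>k<n. v ^ j * laguerre k v * exp_weight v))"
    by (auto simp: laguerre_deriv_def sum_distrib_left sum_distrib_right)
  then show ?thesis
    using integrable_laguerre_power by (auto intro!: Bochner_Integration.integrable_sum)
qed

lemma laguerre_power_exp_at_top: "((\<lambda>v. v ^ j * laguerre n v * exp (- v)) \<longlongrightarrow> 0) at_top"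
proof -
  have "(\<lambda>v. v ^ j * laguerre n v * exp (- v))
      = (\<lambda>v. \<Sum>k=0..n. real (n choose k) * (-1) ^ k / fact k * (v ^ (k + j) / exp v))"
    by (auto simp: laguerre_def sum_distrib_left sum_distrib_right power_add exp_minus divide_inverse
        mult_ac intro!: sum.cong)
  moreover have "((\<lambda>v. \<Sum>k=0..n. real (n choose k) * (-1) ^ k / fact k * (v ^ (k + j) / exp v)) \<longlongrightarrow> (\<Sum>k=0..n. real (n choose k) * (-1) ^ k / fact k * 0)) at_top"
    by (intro tendsto_intros tendsto_power_div_exp_0)
  ultimately show ?thesis by simp
qed

lemma laguerre_deriv_power_exp_at_top: "((\<lambda>v. v ^ j * laguerre_deriv n v * exp (- v)) \<longlongrightarrow> 0) at_top"
proof -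
  have "(\<lambda>v. v ^ j * laguerre_deriv n v * exp (- v)) = (\<lambda>v. - (\<Sum>k<n. v ^ j * laguerre k v * exp (- v)))"
    by (auto simp: laguerre_deriv_def sum_distrib_left sum_distrib_right)
  moreover have "((\<lambda>v. - (\<Sum>k<n. v ^ j * laguerre k v * exp (- v))) \<longlongrightarrow> - (\<Sum>k<n. 0)) at_top"
    by (intro tendsto_intros laguerre_power_exp_at_top)
  ultimately show ?thesis by simp
qed

lemma integral_exp_weight_atMost:
  fixes F p :: "real \<Rightarrow> real"
  assumes F: "\<And>x. x \<ge> 0 \<Longrightarrow> (F has_real_derivative exp (- x) * p x) (at x)"
    and p: "\<And>x. isCont p x" and d: "d \<ge> 0"
  shows "(\<integral>x. indicator {..d} x * (p x * exp_weight x) \<partial>lborel) = F d - F 0"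
proof -
  have "(\<integral>x. indicator {..d} x * (p x * exp_weight x) \<partial>lborel)
      = (\<integral>x. (exp (- x) * p x) * indicator {0..d} x \<partial>lborel)"
  proof (rule integral_cong_AE)
    have [measurable]: "p \<in> borel_measurable borel"
      using p by (intro borel_measurable_continuous_onI continuous_at_imp_continuous_on) auto
    show "(\<lambda>x. indicator {..d} x * (p x * exp_weight x)) \<in> borel_measurable lborel"
      "(\<lambda>x. (exp (- x) * p x) * indicator {0..d} x) \<in> borel_measurable lborel"
      by measurable
    show "AE x in lborel. indicator {..d} x * (p x * exp_weight x) = (exp (- x) * p x) * indicator {0..d} x"
      using AE_lborel_singleton[of 0] by eventually_elim (auto simp: exp_weight_def indicator_def)
  qed
  also have "\<dots> = F d - F 0"
    using d by (intro integral_FTC_Icc_real F continuous_intros p) auto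
  finally show ?thesis .
qed

lemma integral_exp_weight:
  fixes F p :: "real \<Rightarrow> real"
  assumes F: "\<And>x. x \<ge> 0 \<Longrightarrow> (F has_real_derivative exp (- x) * p x) (at x)"
    and p: "\<And>x. isCont p x" and int: "integrable lborel (\<lambda>x. p x * exp_weight x)"
    and lim: "(F \<longlongrightarrow> T) at_top"
  shows "(\<integral>x. p x * exp_weight x \<partial>lborel) = T - F 0"
proof (rule tendsto_unique)
  show "((\<lambda>d. \<integral>x. indicator {..d} x *\<^sub>R (p x * exp_weight x) \<partial>lborel)
      \<longlongrightarrow> (\<integral>x. p x * exp_weight x \<partial>lborel)) at_top"
    by (rule tendsto_integral_at_top[OF _ int]) simp
  have "\<forall>\<^sub>F d in at_top. F d - F 0 = (\<integral>x. indicator {..d} x *\<^sub>R (p x * exp_weight x) \<partial>lborel)"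
    using eventually_ge_at_top[of 0]
    by eventually_elim (simp add: integral_exp_weight_atMost[OF F p])
  then show "((\<lambda>d. \<integral>x. indicator {..d} x *\<^sub>R (p x * exp_weight x) \<partial>lborel) \<longlongrightarrow> T - F 0) at_top"
    by (rule Lim_transform_eventually[rotated]) (intro tendsto_intros lim)
qed simp

section \<open>Pointwise convergence of Laguerre series\<close>

definition laguerre_coeff :: "(real \<Rightarrow> real) \<Rightarrow> nat \<Rightarrow> real" where
  "laguerre_coeff h n = (\<integral>v. h v * (laguerre n v * exp_weight v) \<partial>lborel)"

lemma laguerre_exp_has_deriv:
  "((\<lambda>v. exp (- v) * - (laguerre (Suc n) v - laguerre n v)) has_real_derivative exp (- v) * laguerre (Suc n) v) (at v)"
  by (rule derivative_eq_intros laguerre_Suc_diff_has_deriv refl)+ (simp add: algebra_simps)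

text \<open>Orthogonality to L_0: e^-v L_{m+1} is the derivative of -e^-v (L_{m+1} - L_m), which
  vanishes at infinity and also at 0, where all L_n equal 1. This allows subtracting the constant
  h(u) inside a partial sum.\<close>

lemma laguerre_coeff_const: "laguerre_coeff (\<lambda>_. c) n = (if n = 0 then c else 0)"
proof -
  have "(\<integral>v. laguerre n v * exp_weight v \<partial>lborel) = (if n = 0 then 1 else 0)"
  proof (cases n)
    case 0
    have "(\<integral>v. laguerre 0 v * exp_weight v \<partial>lborel) = 0 - (- exp (- 0))"
    proof (rule integral_exp_weight)
      show "((\<lambda>x. - exp (- x)) has_real_derivative exp (- x) * laguerre 0 x) (at x)" for x :: real
        by (auto intro!: derivative_eq_intros)
      show "((\<lambda>x. - exp (- x)) \<longlongrightarrow> (0::real)) at_top"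
        by real_asymp
    qed (rule isCont_laguerre integrable_laguerre)+
    with 0 show ?thesis by simp
  next
    case (Suc m)
    have "(\<integral>v. laguerre (Suc m) v * exp_weight v \<partial>lborel)
        = 0 - exp (- 0) * - (laguerre (Suc m) 0 - laguerre m 0)"
    proof (rule integral_exp_weight)
      have "((\<lambda>v. - (v ^ 0 * laguerre (Suc m) v * exp (- v) - v ^ 0 * laguerre m v * exp (- v))) \<longlongrightarrow> - (0 - 0)) at_top"
        by (intro tendsto_intros laguerre_power_exp_at_top)
      then show "((\<lambda>v. exp (- v) * - (laguerre (Suc m) v - laguerre m v)) \<longlongrightarrow> 0) at_top"
        by (simp add: algebra_simps)
    qed (rule isCont_laguerre integrable_laguerre laguerre_exp_has_deriv)+
    with Suc show ?thesis by simp
  qed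
  then show ?thesis
    by (simp add: laguerre_coeff_def)
qed

lemma tendsto_laguerre:
  assumes "v > 0"
  shows "(\<lambda>n. laguerre n v) \<longlonglongrightarrow> 0"
proof (rule Lim_null_comparison)
  show "\<forall>\<^sub>F n in sequentially. norm (laguerre n v)
      \<le> 10 * real n powr (-1/4) * (v powr (-1/4) * exp (15 / 16 * v))"
    using eventually_gt_at_top[of 0] by eventually_elim (use abs_laguerre_le assms in auto)
  have "(\<lambda>n. real n powr (-1/4)) \<longlonglongrightarrow> 0"
    by real_asymp
  then show "(\<lambda>n. 10 * real n powr (-1/4) * (v powr (-1/4) * exp (15 / 16 * v))) \<longlonglongrightarrow> 0"
    by (intro tendsto_mult_left_zero tendsto_mult_right_zero)
qed

lemma tendsto_laguerre_deriv_div_sqrt: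
  assumes "v > 0"
  shows "(\<lambda>n. v * laguerre_deriv n v / sqrt n) \<longlonglongrightarrow> 0"
proof (rule Lim_null_comparison)
  show "\<forall>\<^sub>F n in sequentially. norm (v * laguerre_deriv n v / sqrt n)
      \<le> 10 * exp (15 / 16 * v) * (real n powr (1/4) / sqrt n)"
    using eventually_gt_at_top[of 0]
  proof eventually_elim
    case (elim n)
    then show ?case
      using abs_laguerre_deriv_le[OF elim assms] by (simp add: divide_right_mono mult_ac)
  qed
  have "(\<lambda>n. real n powr (1/4) / sqrt n) \<longlonglongrightarrow> 0"
    by real_asymp
  then show "(\<lambda>n. 10 * exp (15 / 16 * v) * (real n powr (1/4) / sqrt n)) \<longlonglongrightarrow> 0"
    by (intro tendsto_mult_right_zero)
qed

text \<open>The Christoffel-Darboux kernel multiplied by v - u; the missing division goes into the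
  difference quotient of the expanded function.\<close>

definition laguerre_kernel :: "real \<Rightarrow> nat \<Rightarrow> real \<Rightarrow> real" where
  "laguerre_kernel u n v = u * laguerre_deriv n u * laguerre n v - laguerre n u * (v * laguerre_deriv n v)"

lemma laguerre_kernel_eq:
  "laguerre_kernel u n v = (v - u) * (\<Sum>k<n. laguerre k u * laguerre k v)"
  using laguerre_christoffel_darboux[of u v n] by (simp add: laguerre_kernel_def algebra_simps)

text \<open>An antiderivative of e^-v \<open>laguerre_kernel u n v\<close>. By the Laguerre
  equation, e^-v v L_n' has derivative -n e^-v L_n, and e^-v (n v L_n + (1 - v) v L_n') has
  derivative (n - 1) e^-v v L_n'. The divisor n - 1 explains the later restriction to n >=
  2.\<close>

definition laguerre_kernel_primitive :: "real \<Rightarrow> nat \<Rightarrow> real \<Rightarrow> real" where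
  "laguerre_kernel_primitive u n v = exp (- v) * (- (u * laguerre_deriv n u) * (v * laguerre_deriv n v) / real n
     - laguerre n u * (real n * (v * laguerre n v) + (1 - v) * (v * laguerre_deriv n v)) / (real n - 1))"

lemma laguerre_kernel_primitive_has_deriv:
  assumes "n \<ge> 2"
  shows "(laguerre_kernel_primitive u n has_real_derivative exp (- v) * laguerre_kernel u n v) (at v)"
proof -
  let ?L = "laguerre n v" and ?D = "laguerre_deriv n v"
  define r s where "r = 1 / real n" and "s = 1 / (real n - 1)"
  have rs: "real n * r = 1" "(real n - 1) * s = 1"
    using assms by (auto simp: r_def s_def)
  have "(laguerre_kernel_primitive u n has_real_derivative
      exp (- v) * (- (u * laguerre_deriv n u) * (v * ?D - real n * ?L) * r
        - laguerre n u * (real n * (v * ?D + ?L) + (1 - v) * (v * ?D - real n * ?L) - v * ?D) * s)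
      - exp (- v) * (- (u * laguerre_deriv n u) * (v * ?D) * r
        - laguerre n u * (real n * (v * ?L) + (1 - v) * (v * ?D)) * s)) (at v)"
    unfolding laguerre_kernel_primitive_def[abs_def] divide_inverse
    by (rule derivative_eq_intros laguerre_deriv_mult_has_deriv laguerre_has_deriv refl)+
       (simp add: r_def s_def divide_inverse algebra_simps)
  also have "exp (- v) * (- (u * laguerre_deriv n u) * (v * ?D - real n * ?L) * r
        - laguerre n u * (real n * (v * ?D + ?L) + (1 - v) * (v * ?D - real n * ?L) - v * ?D) * s)
      - exp (- v) * (- (u * laguerre_deriv n u) * (v * ?D) * r
        - laguerre n u * (real n * (v * ?L) + (1 - v) * (v * ?D)) * s)
     = exp (- v) * (u * laguerre_deriv n u * ?L * (real n * r) - laguerre n u * (v * ?D) * ((real n - 1) * s))"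
    by algebra
  finally show ?thesis
    by (simp add: rs laguerre_kernel_def)
qed

lemma laguerre_kernel_primitive_at_0 [simp]: "laguerre_kernel_primitive u n 0 = 0"
  by (simp add: laguerre_kernel_primitive_def)

lemma laguerre_kernel_primitive_at_top:
  "(laguerre_kernel_primitive u n \<longlongrightarrow> 0) at_top"
proof -
  define a b where "a = - (u * laguerre_deriv n u) / real n" and "b = laguerre n u / (real n - 1)"
  have "laguerre_kernel_primitive u n = (\<lambda>v. a * (v ^ 1 * laguerre_deriv n v * exp (- v))
      - b * (real n * (v ^ 1 * laguerre n v * exp (- v)) + v ^ 1 * laguerre_deriv n v * exp (- v)
        - v ^ 2 * laguerre_deriv n v * exp (- v)))"
    by (auto simp: laguerre_kernel_primitive_def a_def b_def divide_inverse algebra_simps power2_eq_square)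
  moreover have "((\<lambda>v. a * (v ^ 1 * laguerre_deriv n v * exp (- v))
      - b * (real n * (v ^ 1 * laguerre n v * exp (- v)) + v ^ 1 * laguerre_deriv n v * exp (- v)
        - v ^ 2 * laguerre_deriv n v * exp (- v))) \<longlongrightarrow> a * 0 - b * (real n * 0 + 0 - 0)) at_top"
    by (intro tendsto_intros laguerre_power_exp_at_top laguerre_deriv_power_exp_at_top)
  ultimately show ?thesis by simp
qed

text \<open>Each v L_n' is paired with 1 / sqrt n, which makes it tend to 0; the division by n
  supplies exactly two such factors for the product of the two derivatives.\<close>

lemma tendsto_laguerre_kernel_primitive:
  assumes "u > 0" "d > 0"
  shows "(\<lambda>n. laguerre_kernel_primitive u n d) \<longlonglongrightarrow> 0"
proof -
  let ?X = "\<lambda>v n. v * laguerre_deriv n v / sqrt n"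
  have "(\<lambda>n. exp (- d) * (- (?X u n * ?X d n) - laguerre n u *
      ((real n / (real n - 1)) * (d * laguerre n d) + (1 - d) * (?X d n * (sqrt n / (real n - 1))))))
    \<longlonglongrightarrow> exp (- d) * (- (0 * 0) - 0 * (1 * (d * 0) + (1 - d) * (0 * 0)))"
  proof (intro tendsto_intros tendsto_laguerre tendsto_laguerre_deriv_div_sqrt assms)
    show "(\<lambda>n. real n / (real n - 1)) \<longlonglongrightarrow> 1" by real_asymp
    show "(\<lambda>n. sqrt n / (real n - 1)) \<longlonglongrightarrow> 0" by real_asymp
  qed
  moreover have "\<forall>\<^sub>F n in sequentially. exp (- d) * (- (?X u n * ?X d n) - laguerre n u *
      ((real n / (real n - 1)) * (d * laguerre n d) + (1 - d) * (?X d n * (sqrt n / (real n - 1)))))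
      = laguerre_kernel_primitive u n d"
    using eventually_ge_at_top[of 2]
  proof eventually_elim
    case (elim n)
    have 1: "?X u n * ?X d n = (u * laguerre_deriv n u) * (d * laguerre_deriv n d) / real n"
      using elim by simp
    have 2: "?X d n * (sqrt n / (real n - 1)) = d * laguerre_deriv n d / (real n - 1)"
      using elim by simp
    show ?case
      unfolding laguerre_kernel_primitive_def 1 2 by (simp add: ring_distribs add_divide_distrib diff_divide_distrib)
  qed
  ultimately have "(\<lambda>n. laguerre_kernel_primitive u n d)
    \<longlonglongrightarrow> exp (- d) * (- (0 * 0) - 0 * (1 * (d * 0) + (1 - d) * (0 * 0)))"
    by (rule Lim_transform_eventually)
  then show ?thesis by simp
qed

text \<open>The rates n^(1/4) and n^(-1/4) cancel in each product, leaving a bound independent of n,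
  as dominated convergence requires.\<close>

lemma abs_laguerre_kernel_le:
  assumes "n > 0" "u > 0" "v > 0"
  shows "\<bar>laguerre_kernel u n v\<bar> \<le> 100 * exp (15 / 16 * u) * ((v powr (-1/4) + u powr (-1/4)) * exp (15 / 16 * v))"
proof -
  have n: "real n powr (1/4) * real n powr (-1/4) = 1"
    using assms by (simp flip: powr_add)
  have "\<bar>laguerre_kernel u n v\<bar> \<le> \<bar>u * laguerre_deriv n u\<bar> * \<bar>laguerre n v\<bar> + \<bar>laguerre n u\<bar> * \<bar>v * laguerre_deriv n v\<bar>"
    unfolding laguerre_kernel_def by (rule order_trans[OF abs_triangle_ineq4]) (simp add: abs_mult)
  also have "\<dots> \<le> (10 * real n powr (1/4) * exp (15 / 16 * u)) * (10 * real n powr (-1/4) * (v powr (-1/4) * exp (15 / 16 * v)))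
     + (10 * real n powr (-1/4) * (u powr (-1/4) * exp (15 / 16 * u))) * (10 * real n powr (1/4) * exp (15 / 16 * v))"
    using assms by (intro add_mono mult_mono abs_laguerre_le abs_laguerre_deriv_le) auto
  also have "\<dots> = (real n powr (1/4) * real n powr (-1/4)) * (100 * exp (15 / 16 * u) * ((v powr (-1/4) + u powr (-1/4)) * exp (15 / 16 * v)))"
    by (simp add: algebra_simps)
  also have "\<dots> = 100 * exp (15 / 16 * u) * ((v powr (-1/4) + u powr (-1/4)) * exp (15 / 16 * v))"
    unfolding n by simp
  finally show ?thesis .
qed

text \<open>Against the growth exp (15v/16) of the kernel, the weight e^-v retains only the decay
  exp (-v/16).\<close>

lemma integrable_exp_weight_scaled:
  assumes "s > (-1::real)"
  shows "integrable lborel (\<lambda>v. v powr s * exp_weight (v / 16))"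
proof -
  have "integrable lborel (\<lambda>v. 16 powr s * ((0 + (1 / 16) * v) powr s * exp_weight (0 + (1 / 16) * v)))"
    by (intro integrable_mult_right lborel_integrable_real_affine[OF integrable_exp_weight_powr[OF assms], of "1 / 16" 0]) simp
  also have "(\<lambda>v. 16 powr s * ((0 + (1 / 16) * v) powr s * exp_weight (0 + (1 / 16) * v)))
      = (\<lambda>v. v powr s * exp_weight (v / 16))"
  proof (intro ext)
    fix v :: real
    show "16 powr s * ((0 + (1 / 16) * v) powr s * exp_weight (0 + (1 / 16) * v)) = v powr s * exp_weight (v / 16)"
    proof (cases "v > 0")
      case True
      then have "v powr s = (16 * (v / 16)) powr s" by simp
      also have "\<dots> = 16 powr s * (v / 16) powr s"
        using True by (subst powr_mult) auto
      finally show ?thesis by simp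
    qed (simp add: exp_weight_def)
  qed
  finally show ?thesis .
qed

text \<open>The Lipschitz bound is anchored at the single point u. It makes the difference quotient
  bounded, while h may jump elsewhere.\<close>

theorem laguerre_series_sums_at_Lipschitz_point:
  assumes h [measurable]: "h \<in> borel_measurable borel" and B: "\<And>v. v > 0 \<Longrightarrow> \<bar>h v\<bar> \<le> B"
    and u: "u > 0" and C: "\<And>v. v > 0 \<Longrightarrow> \<bar>h v - h u\<bar> \<le> C * \<bar>v - u\<bar>"
  shows "(\<lambda>n. laguerre_coeff h n * laguerre n u) sums h u"
proof -
  \<comment> \<open>At v = u the quotient is 0 by the convention for division by zero. This is
    consistent with \<open>hg\<close>, where both sides vanish at u, and the weight vanishes for v
    <= 0.\<close>
  define g where "g = (\<lambda>v. if v > 0 then (h v - h u) / (v - u) else 0)"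
  have [measurable]: "g \<in> borel_measurable borel"
    unfolding g_def by measurable
  have "0 \<le> C"
    using C[of "u + 1"] u by (simp add: order_trans[OF abs_ge_zero])
  then have gC: "\<bar>g v\<bar> \<le> C" for v
    using C[of v] by (auto simp: g_def divide_simps mult.commute)
  have hg: "(h v - h u) * exp_weight v = g v * (v - u) * exp_weight v" for v
    by (auto simp: g_def exp_weight_def)
  define M where "M = (\<lambda>n v. laguerre_kernel u n v * exp_weight v)"
  have M [measurable]: "M n \<in> borel_measurable borel" for n
    unfolding M_def laguerre_kernel_def by measurable
  have int: "integrable lborel (\<lambda>v. h v * (laguerre n v * exp_weight v))" for n
    by (rule integrable_mult_bounded[OF integrable_laguerre])
       (use B in \<open>auto simp: exp_weight_def indicator_def split: if_splits\<close>)
  have int0: "integrable lborel (\<lambda>v. h u * (laguerre n v * exp_weight v))" for n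
    using integrable_laguerre by simp
  \<comment> \<open>With n > 0 the sum contains the index 0, the only one contributing for the
    constant function h(u).\<close>
  have partial: "(\<Sum>k<n. laguerre_coeff h k * laguerre k u) - h u = (\<integral>v. g v * M n v \<partial>lborel)" if "n > 0" for n
  proof -
    have "(\<Sum>k<n. laguerre_coeff (\<lambda>_. h u) k * laguerre k u) = (\<Sum>k<n. if k = 0 then h u else 0)"
      by (intro sum.cong) (auto simp: laguerre_coeff_const)
    also have "\<dots> = h u"
      using that by simp
    finally have "(\<Sum>k<n. laguerre_coeff h k * laguerre k u) - h u
        = (\<Sum>k<n. (laguerre_coeff h k - laguerre_coeff (\<lambda>_. h u) k) * laguerre k u)"
      by (simp add: sum_subtractf left_diff_distrib)
    also have "\<dots> = (\<Sum>k<n. \<integral>v. (h v * (laguerre k v * exp_weight v) - h u * (laguerre k v * exp_weight v)) * laguerre k u \<partial>lborel)"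
      unfolding laguerre_coeff_def using int int0 by simp
    also have "\<dots> = (\<integral>v. (\<Sum>k<n. (h v * (laguerre k v * exp_weight v) - h u * (laguerre k v * exp_weight v)) * laguerre k u) \<partial>lborel)"
      using int int0 by (intro Bochner_Integration.integral_sum[symmetric]) auto
    also have "\<dots> = (\<integral>v. g v * M n v \<partial>lborel)"
    proof (intro Bochner_Integration.integral_cong refl)
      fix v
      have "(\<Sum>k<n. (h v * (laguerre k v * exp_weight v) - h u * (laguerre k v * exp_weight v)) * laguerre k u)
          = ((h v - h u) * exp_weight v) * (\<Sum>k<n. laguerre k u * laguerre k v)"
        unfolding sum_distrib_left by (intro sum.cong) (auto simp: algebra_simps)
      also have "\<dots> = g v * M n v"
        unfolding hg by (simp add: M_def laguerre_kernel_eq)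
      finally show "(\<Sum>k<n. (h v * (laguerre k v * exp_weight v) - h u * (laguerre k v * exp_weight v)) * laguerre k u)
          = g v * M n v" .
    qed
    finally show ?thesis .
  qed
  define w where "w = (\<lambda>v. 100 * exp (15 / 16 * u) * (v powr (-1/4) * exp_weight (v / 16) + u powr (-1/4) * (v powr 0 * exp_weight (v / 16))))"
  have Mw: "\<bar>M n v\<bar> \<le> w v" if "n > 0" for n v
  proof (cases "v > 0")
    case True
    have "\<bar>M n v\<bar> = \<bar>laguerre_kernel u n v\<bar> * exp (- v)"
      using True by (simp add: M_def exp_weight_def abs_mult)
    also have "\<dots> \<le> 100 * exp (15 / 16 * u) * ((v powr (-1/4) + u powr (-1/4)) * exp (15 / 16 * v)) * exp (- v)"
      using that u True by (intro mult_right_mono abs_laguerre_kernel_le) auto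
    also have "\<dots> = 100 * exp (15 / 16 * u) * ((v powr (-1/4) + u powr (-1/4)) * (exp (15 / 16 * v) * exp (- v)))"
      by (simp only: mult_ac)
    also have "exp (15 / 16 * v) * exp (- v) = exp_weight (v / 16)"
      using True by (simp add: exp_weight_def flip: exp_add)
    finally show ?thesis
      using True by (simp add: w_def distrib_right)
  qed (simp add: M_def w_def exp_weight_def)
  have kernel_half: "(\<integral>v. indicator {..d} v * M n v \<partial>lborel) = laguerre_kernel_primitive u n d"
    if "n \<ge> 2" "d \<ge> 0" for n d
  proof -
    have "(\<integral>v. indicator {..d} v * M n v \<partial>lborel)
        = laguerre_kernel_primitive u n d - laguerre_kernel_primitive u n 0"
      unfolding M_def using that
      by (intro integral_exp_weight_atMost laguerre_kernel_primitive_has_deriv)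
         (auto simp: laguerre_kernel_def intro!: continuous_intros)
    then show ?thesis by simp
  qed
  \<comment> \<open>The shift by 2 puts every index in the range where the primitive of the kernel
    is valid.\<close>
  have "(\<lambda>n. \<integral>v. g v * M (n + 2) v \<partial>lborel) \<longlonglongrightarrow> 0"
  proof (rule Riemann_Lebesgue_bounded)
    show "integrable lborel w"
      unfolding w_def
      by (intro integrable_mult_right Bochner_Integration.integrable_add integrable_exp_weight_scaled) auto
    show "\<bar>M (n + 2) v\<bar> \<le> w v" for n v
      by (rule Mw) simp
    show "(\<lambda>n. \<integral>v. indicator {..d} v * M (n + 2) v \<partial>lborel) \<longlonglongrightarrow> 0" for d
    proof (cases "d > 0")
      case True
      have "(\<lambda>n. laguerre_kernel_primitive u (n + 2) d) \<longlonglongrightarrow> 0"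
        using LIMSEQ_ignore_initial_segment[OF tendsto_laguerre_kernel_primitive[OF u True]] .
      then show ?thesis
        using True by (simp add: kernel_half)
    next
      case False
      then have "(\<lambda>v. indicator {..d} v * M n v) = (\<lambda>_. 0)" for n
        by (auto simp: M_def exp_weight_def indicator_def)
      then show ?thesis by simp
    qed
    have "(\<integral>v. M (n + 2) v \<partial>lborel) = 0 - laguerre_kernel_primitive u (n + 2) 0" for n
      unfolding M_def
    proof (rule integral_exp_weight)
      show "isCont (laguerre_kernel u (n + 2)) x" for x
        unfolding laguerre_kernel_def by (intro continuous_intros)
      have "(\<lambda>v. laguerre_kernel u (n + 2) v * exp_weight v)
          = (\<lambda>v. u * laguerre_deriv (n + 2) u * (laguerre (n + 2) v * exp_weight v)
            - laguerre (n + 2) u * (v ^ 1 * laguerre_deriv (n + 2) v * exp_weight v))"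
        by (auto simp: laguerre_kernel_def algebra_simps)
      then show "integrable lborel (\<lambda>v. laguerre_kernel u (n + 2) v * exp_weight v)"
        by (simp only:) (intro Bochner_Integration.integrable_diff integrable_mult_right
            integrable_laguerre integrable_laguerre_deriv_power)
    qed (auto intro: laguerre_kernel_primitive_has_deriv laguerre_kernel_primitive_at_top)
    then show "(\<lambda>n. \<integral>v. M (n + 2) v \<partial>lborel) \<longlonglongrightarrow> 0"
      by simp
  qed (use gC in auto)
  then have "(\<lambda>n. (\<Sum>k<n + 2. laguerre_coeff h k * laguerre k u) - h u) \<longlonglongrightarrow> 0"
    by (simp only: partial zero_less_numeral add_pos_nonneg le0 trans_less_add2)
  then have "(\<lambda>n. (\<Sum>k<n + 2. laguerre_coeff h k * laguerre k u)) \<longlonglongrightarrow> h u"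
    by (rule LIM_zero_cancel)
  then show ?thesis
    unfolding sums_def by (rule LIMSEQ_offset)
qed

section \<open>Expansion of a step function and of the fractional part\<close>

text \<open>The integral over (0, a] has an elementary primitive and is subtracted from the
  coefficient of the constant 1.\<close>

lemma laguerre_coeff_indicator:
  assumes "a > 0"
  shows "laguerre_coeff (indicator {a<..}) 0 = exp (- a)"
    and "laguerre_coeff (indicator {a<..}) (Suc m) = exp (- a) * (laguerre (Suc m) a - laguerre m a)"
proof -
  have split: "laguerre_coeff (indicator {a<..}) n = laguerre_coeff (\<lambda>_. 1) n
      - (\<integral>v. indicator {..a} v * (laguerre n v * exp_weight v) \<partial>lborel)" for n
  proof -
    have "integrable lborel (\<lambda>v. indicator {..a} v * (laguerre n v * exp_weight v))"
      by (rule integrable_mult_bounded[OF integrable_laguerre, where B = 1]) (auto simp: indicator_def)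
    moreover have "(\<lambda>v. indicator {a<..} v * (laguerre n v * exp_weight v))
        = (\<lambda>v. 1 * (laguerre n v * exp_weight v) - indicator {..a} v * (laguerre n v * exp_weight v))"
      by (auto simp: indicator_def)
    ultimately show ?thesis
      unfolding laguerre_coeff_def using integrable_laguerre[of n] by simp
  qed
  have "(\<integral>v. indicator {..a} v * (laguerre 0 v * exp_weight v) \<partial>lborel) = - exp (- a) - (- exp (- 0))"
    using assms by (intro integral_exp_weight_atMost isCont_laguerre) (auto intro!: derivative_eq_intros)
  then show "laguerre_coeff (indicator {a<..}) 0 = exp (- a)"
    unfolding split by (simp add: laguerre_coeff_const)
  have "(\<integral>v. indicator {..a} v * (laguerre (Suc m) v * exp_weight v) \<partial>lborel)
      = exp (- a) * - (laguerre (Suc m) a - laguerre m a) - exp (- 0) * - (laguerre (Suc m) 0 - laguerre m 0)"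
    using assms by (intro integral_exp_weight_atMost isCont_laguerre laguerre_exp_has_deriv) auto
  then show "laguerre_coeff (indicator {a<..}) (Suc m) = exp (- a) * (laguerre (Suc m) a - laguerre m a)"
    unfolding split by (simp add: laguerre_coeff_const algebra_simps)
qed

text \<open>
  The sum \<open>\<Phi>(a) = \<Sum>k<n. (L\<^sub>k\<^sub>+\<^sub>1(a) - L\<^sub>k(a))\<^sup>2\<close> satisfies \<open>\<Phi>' = 1 - L\<^sub>n\<^sup>2 + \<Phi>\<close> by telescoping.
\<close>

lemma sum_laguerre_diff_squares:
  assumes "a \<ge> 0"
  shows "exp (- a) * (1 + (\<Sum>k<n. (laguerre (Suc k) a - laguerre k a)\<^sup>2))
    = 1 - (\<integral>v. indicator {..a} v * ((laguerre n v)\<^sup>2 * exp_weight v) \<partial>lborel)"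
proof -
  let ?S = "\<lambda>v. \<Sum>k<n. (laguerre (Suc k) v - laguerre k v)\<^sup>2"
  let ?F = "\<lambda>v. - (exp (- v) * (1 + ?S v))"
  have "(?F has_real_derivative exp (- v) * (laguerre n v)\<^sup>2) (at v)" for v
  proof -
    let ?S' = "\<Sum>k<n. 2 * (laguerre (Suc k) v - laguerre k v) * - laguerre k v"
    have "((\<lambda>v. (laguerre (Suc k) v - laguerre k v)\<^sup>2) has_real_derivative
        2 * (laguerre (Suc k) v - laguerre k v) * - laguerre k v) (at v)" for k
      by (rule derivative_eq_intros laguerre_Suc_diff_has_deriv refl)+ simp
    then have S: "(?S has_real_derivative ?S') (at v)"
      by (intro DERIV_sum)
    have "(?F has_real_derivative - (- exp (- v) * (1 + ?S v) + exp (- v) * ?S')) (at v)"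
      by (rule derivative_eq_intros S refl)+ simp
    moreover have "1 + ?S v - ?S' = (laguerre n v)\<^sup>2"
      by (induction n) (simp_all add: power2_eq_square algebra_simps)
    moreover have "- (- e * (1 + s) + e * t) = e * (1 + s - t)" for e s t :: real
      by (simp add: algebra_simps)
    ultimately show ?thesis by (simp only:)
  qed
  then have "(\<integral>v. indicator {..a} v * ((laguerre n v)\<^sup>2 * exp_weight v) \<partial>lborel) = ?F a - ?F 0"
    using assms by (intro integral_exp_weight_atMost) (auto intro!: continuous_intros)
  then show ?thesis by simp
qed

text \<open>L_n tends to 0 pointwise on (0, a], and there L_n^2 is dominated by a multiple of
  v^(-1/2), since the growth factor is at most exp (15a/8).\<close>

lemma tendsto_integral_laguerre_square:
  "(\<lambda>n. \<integral>v. indicator {..a} v * ((laguerre n v)\<^sup>2 * exp_weight v) \<partial>lborel) \<longlonglongrightarrow> 0"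
proof -
  have "(\<lambda>n. \<integral>v. indicator {..a} v * ((laguerre (Suc n) v)\<^sup>2 * exp_weight v) \<partial>lborel)
      \<longlonglongrightarrow> (\<integral>v. indicator {..a} v * (0 * exp_weight v) \<partial>lborel)"
  proof (rule integral_dominated_convergence)
    show "integrable lborel (\<lambda>v. 100 * exp (15 / 8 * a) * (v powr (-1/2) * exp_weight v))"
      by (intro integrable_mult_right integrable_exp_weight_powr) auto
    show "AE v in lborel. (\<lambda>n. indicator {..a} v * ((laguerre (Suc n) v)\<^sup>2 * exp_weight v))
        \<longlonglongrightarrow> indicator {..a} v * (0 * exp_weight v)"
    proof (intro AE_I2)
      fix v :: real
      show "(\<lambda>n. indicator {..a} v * ((laguerre (Suc n) v)\<^sup>2 * exp_weight v)) \<longlonglongrightarrow> indicator {..a} v * (0 * exp_weight v)"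
      proof (cases "v > 0")
        case True
        have "(\<lambda>n. indicator {..a} v * ((laguerre (Suc n) v)\<^sup>2 * exp_weight v))
            \<longlonglongrightarrow> indicator {..a} v * (0\<^sup>2 * exp_weight v)"
          by (intro tendsto_intros LIMSEQ_Suc[OF tendsto_laguerre[OF True]])
        then show ?thesis by simp
      qed (simp add: exp_weight_def)
    qed
    show "AE v in lborel. norm (indicator {..a} v * ((laguerre (Suc n) v)\<^sup>2 * exp_weight v))
        \<le> 100 * exp (15 / 8 * a) * (v powr (-1/2) * exp_weight v)" for n
    proof (intro AE_I2)
      fix v :: real
      show "norm (indicator {..a} v * ((laguerre (Suc n) v)\<^sup>2 * exp_weight v))
        \<le> 100 * exp (15 / 8 * a) * (v powr (-1/2) * exp_weight v)"
      proof (cases "0 < v \<and> v \<le> a")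
        case True
        have "(laguerre (Suc n) v)\<^sup>2 * sqrt v \<le> (laguerre (Suc n) v)\<^sup>2 * sqrt (real (Suc n) * v)"
          using True by (intro mult_left_mono) (auto simp: mult_le_cancel_right1)
        also have "\<dots> \<le> 100 * exp (15 / 8 * v)"
          using True by (intro laguerre_square_le) auto
        also have "\<dots> \<le> 100 * exp (15 / 8 * a)"
          using True by simp
        finally have "(laguerre (Suc n) v)\<^sup>2 \<le> 100 * exp (15 / 8 * a) * v powr (-1/2)"
          using True by (simp add: powr_minus_divide powr_half_sqrt pos_le_divide_eq)
        then have "(laguerre (Suc n) v)\<^sup>2 * exp_weight v \<le> 100 * exp (15 / 8 * a) * v powr (-1/2) * exp_weight v"
          by (intro mult_right_mono) auto
        then show ?thesis
          using True by (simp add: mult_ac)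
      qed (auto simp: exp_weight_def indicator_def)
    qed
  qed auto
  then have "(\<lambda>n. \<integral>v. indicator {..a} v * ((laguerre (Suc n) v)\<^sup>2 * exp_weight v) \<partial>lborel) \<longlonglongrightarrow> 0"
    by simp
  then show ?thesis
    by (rule LIMSEQ_imp_Suc)
qed

text \<open>With d_k = L_{k+1}(a) - L_k(a), the terms satisfy 2 d_k L_{k+1} = L_{k+1}^2 - L_k^2 +
  d_k^2. The first part telescopes and \<open>sum_laguerre_diff_squares\<close> evaluates the
  second, so half of a quantity tending to 1 remains.\<close>

theorem laguerre_series_sums_at_jump:
  assumes a: "a > 0"
  shows "(\<lambda>n. laguerre_coeff (indicator {a<..}) n * laguerre n a) sums (1 / 2)"
proof -
  let ?d = "\<lambda>k. laguerre (Suc k) a - laguerre k a"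
  let ?I = "\<lambda>n. \<integral>v. indicator {..a} v * ((laguerre n v)\<^sup>2 * exp_weight v) \<partial>lborel"
  have partial: "(\<Sum>k<Suc n. laguerre_coeff (indicator {a<..}) k * laguerre k a)
      = (exp (- a) * (laguerre n a)\<^sup>2 + (1 - ?I n)) / 2" for n
  proof -
    have tel: "2 * (\<Sum>k<n. ?d k * laguerre (Suc k) a) = (laguerre n a)\<^sup>2 - 1 + (\<Sum>k<n. (?d k)\<^sup>2)"
      by (induction n) (simp_all add: power2_eq_square algebra_simps)
    have "(\<Sum>k<Suc n. laguerre_coeff (indicator {a<..}) k * laguerre k a)
        = exp (- a) + (\<Sum>k<n. exp (- a) * ?d k * laguerre (Suc k) a)"
      unfolding sum.lessThan_Suc_shift by (simp add: laguerre_coeff_indicator[OF a])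
    also have "\<dots> = exp (- a) * (1 + (\<Sum>k<n. ?d k * laguerre (Suc k) a))"
      by (simp add: sum_distrib_left distrib_left mult.assoc)
    also have "\<dots> = exp (- a) * (2 + 2 * (\<Sum>k<n. ?d k * laguerre (Suc k) a)) / 2"
      by (simp add: distrib_left)
    also have "\<dots> = (exp (- a) * (laguerre n a)\<^sup>2 + exp (- a) * (1 + (\<Sum>k<n. (?d k)\<^sup>2))) / 2"
      unfolding tel by (simp add: algebra_simps)
    finally show ?thesis
      unfolding sum_laguerre_diff_squares[OF less_imp_le[OF a]] .
  qed
  have "(\<lambda>n. (exp (- a) * (laguerre n a)\<^sup>2 + (1 - ?I n)) / 2) \<longlonglongrightarrow> (exp (- a) * 0\<^sup>2 + (1 - 0)) / 2"
    by (intro tendsto_intros tendsto_laguerre[OF a] tendsto_integral_laguerre_square) simp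
  then have "(\<lambda>n. \<Sum>k<Suc n. laguerre_coeff (indicator {a<..}) k * laguerre k a) \<longlonglongrightarrow> 1 / 2"
    unfolding partial by simp
  then show ?thesis
    unfolding sums_def by (rule LIMSEQ_imp_Suc)
qed

text \<open>The factor of e^-v in the derivative of v^k e^-v. For k = 0 the truncated exponent k - 1
  is harmless because of the factor k.\<close>

definition power_exp_deriv :: "nat \<Rightarrow> real \<Rightarrow> real" where
  "power_exp_deriv k v = real k * v ^ (k - 1) - v ^ k"

lemma power_exp_deriv_measurable [measurable]: "power_exp_deriv k \<in> borel_measurable borel"
  unfolding power_exp_deriv_def[abs_def] by measurable

lemma integrable_power_exp_deriv: "integrable lborel (\<lambda>v. power_exp_deriv k v * exp_weight v)"
  unfolding power_exp_deriv_def left_diff_distrib mult.assoc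
  by (intro Bochner_Integration.integrable_diff integrable_mult_right integrable_exp_weight_power)

lemma integrable_frac_exp:
  "integrable lborel f \<Longrightarrow> integrable lborel (\<lambda>v. frac (exp v) * f v)" for f :: "real \<Rightarrow> real"
proof (rule integrable_mult_bounded[where B = 1])
  show "\<bar>frac (exp v)\<bar> \<le> 1" for v :: real
    using frac_ge_0[of "exp v"] frac_lt_1[of "exp v"] by linarith
qed (auto simp: frac_def)

text \<open>Euler summation by induction on N: between ln N and ln (N + 1) the fractional part is
  e^v - N, so the integrand has an elementary primitive, whose increment is the next term of the sum
  and of the logarithmic power. The correction 0^k is the term m = 1, which is 1 for k = 0 and 0
  otherwise.\<close>

lemma integral_frac_exp_atMost_ln:
  assumes "N \<ge> 1"
  shows "(\<integral>v. indicator {..ln (real N)} v * (frac (exp v) * (power_exp_deriv k v * exp_weight v)) \<partial>lborel)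
    = (\<Sum>m=1..N. ln (real m) ^ k / real m) - ln (real N) ^ (k + 1) / real (k + 1) - 0 ^ k"
  using assms
proof (induction N rule: dec_induct)
  case base
  have "(\<lambda>v. indicator {..ln (real 1)} v * (frac (exp v) * (power_exp_deriv k v * exp_weight v))) = (\<lambda>_. 0)"
    by (auto simp: indicator_def exp_weight_def)
  then show ?case by simp
next
  case (step N)
  define a b where "a = ln (real N)" and "b = ln (real (Suc N))"
  have ab: "0 \<le> a" "a < b" "exp a = real N" "exp b = real (Suc N)"
    using step by (auto simp: a_def b_def)
  let ?p = "power_exp_deriv k"
  let ?f = "\<lambda>v. frac (exp v) * (?p v * exp_weight v)"
  have f [measurable]: "?f \<in> borel_measurable borel"
    by (simp add: frac_def)
  have f_int: "integrable lborel ?f"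
    by (intro integrable_frac_exp integrable_power_exp_deriv)
  let ?q = "\<lambda>v. ?p v - real N * (exp (- v) * ?p v)"
  have p: "((\<lambda>v. v ^ k) has_real_derivative real k * v ^ (k - 1)) (at v)" for v :: real
    by (auto intro!: derivative_eq_intros)
  have int: "integrable lborel (\<lambda>v. indicator {..a} v * ?f v)" "integrable lborel (\<lambda>v. indicator {a<..b} v * ?f v)"
    by (rule integrable_mult_bounded[OF f_int, where B = 1]; auto simp: indicator_def)+
  have "(\<lambda>v. indicator {..b} v * ?f v) = (\<lambda>v. indicator {..a} v * ?f v + indicator {a<..b} v * ?f v)"
    using ab by (auto simp: indicator_def)
  then have "(\<integral>v. indicator {..b} v * ?f v \<partial>lborel)
      = (\<integral>v. indicator {..a} v * ?f v \<partial>lborel) + (\<integral>v. indicator {a<..b} v * ?f v \<partial>lborel)"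
    using int by simp
  also have "(\<integral>v. indicator {a<..b} v * ?f v \<partial>lborel) = (\<integral>v. ?q v * indicator {a..b} v \<partial>lborel)"
  proof (rule integral_cong_AE)
    \<comment> \<open>The endpoints are discarded as null sets; strictly between them the floor of
      exp v is N.\<close>
    show "AE v in lborel. indicator {a<..b} v * ?f v = ?q v * indicator {a..b} v"
      using AE_lborel_singleton[of a] AE_lborel_singleton[of b]
    proof eventually_elim
      case (elim v)
      show ?case
      proof (cases "v \<in> {a<..<b}")
        case True
        then have "real N < exp v" "exp v < real N + 1"
          using ab by (metis exp_less_mono greaterThanLessThan_iff of_nat_Suc add.commute)+
        then have "\<lfloor>exp v\<rfloor> = int N"
          by (intro floor_unique) auto
        then have fr: "frac (exp v) = exp v - real N"
          by (simp add: frac_def)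
        have "(x - m) * (q * e) = q * (x * e) - m * (e * q)" for x m q e :: real
          by (simp add: algebra_simps)
        then have "(exp v - real N) * (?p v * exp (- v)) = ?p v * (exp v * exp (- v)) - real N * (exp (- v) * ?p v)" .
        also have "exp v * exp (- v) = 1"
          by (simp flip: exp_add)
        finally show ?thesis
          unfolding fr using True ab by (simp add: exp_weight_def)
      qed (use elim in \<open>auto simp: indicator_def\<close>)
    qed
  qed auto
  also have "(\<integral>v. ?q v * indicator {a..b} v \<partial>lborel)
      = (b ^ k - b ^ Suc k / real (Suc k) - real N * (exp (- b) * b ^ k))
        - (a ^ k - a ^ Suc k / real (Suc k) - real N * (exp (- a) * a ^ k))"
  proof (rule integral_FTC_Icc_real)
    show "((\<lambda>v. v ^ k - v ^ Suc k / real (Suc k) - real N * (exp (- v) * v ^ k)) has_real_derivative ?q v) (at v)" for v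
    proof -
      have p2: "((\<lambda>v. v ^ Suc k / real (Suc k)) has_real_derivative v ^ k) (at v)"
        using DERIV_cdivide[OF DERIV_pow[of "Suc k" v], of "real (Suc k)"]
        by (simp del: of_nat_Suc power_Suc)
      have "((\<lambda>v. exp (- v) * v ^ k) has_real_derivative exp (- v) * ?p v) (at v)"
        by (rule derivative_eq_intros p refl)+ (simp add: power_exp_deriv_def algebra_simps)
      from DERIV_diff[OF DERIV_diff[OF p p2] DERIV_cmult[OF this]]
      show ?thesis
        by (simp only: power_exp_deriv_def)
    qed
    show "isCont ?q v" for v
      unfolding power_exp_deriv_def by (intro continuous_intros)
  qed (use ab in auto)
  also have "exp (- b) = 1 / real (Suc N)"
    using ab by (simp add: exp_minus divide_inverse)
  also have "exp (- a) = 1 / real N"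
    using ab by (simp add: exp_minus divide_inverse)
  finally have *: "(\<integral>v. indicator {..b} v * ?f v \<partial>lborel)
      = (\<integral>v. indicator {..a} v * ?f v \<partial>lborel)
      + ((b ^ k - b ^ Suc k / real (Suc k) - real N * (1 / real (Suc N) * b ^ k))
        - (a ^ k - a ^ Suc k / real (Suc k) - real N * (1 / real N * a ^ k)))" .
  have "b ^ k - real N * (1 / real (Suc N) * b ^ k) = b ^ k / real (Suc N)"
    by (simp add: field_simps)
  moreover have "real N * (1 / real N * a ^ k) = a ^ k"
    using step by simp
  ultimately show ?case
    using * step.IH by (simp add: a_def[symmetric] b_def[symmetric] del: of_nat_Suc)
qed

text \<open>Absolute integrability makes the truncated integrals converge. This also proves that the
  limit in \<open>stieltjes\<close> exists, which \<open>lim\<close> by itself does not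
  guarantee.\<close>

lemma stieltjes_eq_integral:
  "stieltjes k = 0 ^ k + (\<integral>v. frac (exp v) * (power_exp_deriv k v * exp_weight v) \<partial>lborel)"
proof -
  let ?f = "\<lambda>v. frac (exp v) * (power_exp_deriv k v * exp_weight v)"
  have "filterlim (\<lambda>N. ln (real N)) at_top sequentially"
    by real_asymp
  moreover have "((\<lambda>y. \<integral>v. indicator {..y} v *\<^sub>R ?f v \<partial>lborel) \<longlongrightarrow> (\<integral>v. ?f v \<partial>lborel)) at_top"
    by (rule tendsto_integral_at_top) (auto intro: integrable_frac_exp integrable_power_exp_deriv)
  ultimately have "(\<lambda>N. \<integral>v. indicator {..ln (real N)} v *\<^sub>R ?f v \<partial>lborel) \<longlonglongrightarrow> (\<integral>v. ?f v \<partial>lborel)"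
    by (rule filterlim_compose[rotated])
  then have "(\<lambda>N. 0 ^ k + (\<integral>v. indicator {..ln (real N)} v *\<^sub>R ?f v \<partial>lborel)) \<longlonglongrightarrow> 0 ^ k + (\<integral>v. ?f v \<partial>lborel)"
    by (intro tendsto_intros)
  moreover have "\<forall>\<^sub>F N in sequentially. 0 ^ k + (\<integral>v. indicator {..ln (real N)} v *\<^sub>R ?f v \<partial>lborel)
      = (\<Sum>m=1..N. ln (real m) ^ k / real m) - ln (real N) ^ (k + 1) / real (k + 1)"
    using eventually_ge_at_top[of 1] by eventually_elim (simp add: integral_frac_exp_atMost_ln)
  ultimately have "(\<lambda>N. (\<Sum>m=1..N. ln (real m) ^ k / real m) - ln (real N) ^ (k + 1) / real (k + 1))
      \<longlonglongrightarrow> 0 ^ k + (\<integral>v. ?f v \<partial>lborel)"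
    by (rule Lim_transform_eventually)
  then show ?thesis
    unfolding stieltjes_def by (rule limI)
qed

text \<open>The identity e^-v L_{m+1} = -(e^-v (L_{m+1} - L_m))' expanded over the monomials of
  L_{m+1} - L_m.\<close>

lemma laguerre_Suc_eq_power_exp_deriv:
  "laguerre (Suc m) v
    = - (\<Sum>k=0..m. real (m choose k) * (-1) ^ Suc k / fact (Suc k) * power_exp_deriv (Suc k) v)"
proof -
  let ?c = "\<lambda>k. real (m choose k) * (-1) ^ Suc k / fact (Suc k)"
  have "((\<lambda>u. laguerre (Suc m) u - laguerre m u) has_real_derivative
      (\<Sum>k=0..m. ?c k * (real (Suc k) * v ^ k))) (at v)"
    unfolding laguerre_Suc_diff by (rule sum_power_Suc_has_deriv)
  with laguerre_Suc_diff_has_deriv have "(\<Sum>k=0..m. ?c k * (real (Suc k) * v ^ k)) = - laguerre m v"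
    by (rule DERIV_unique[symmetric])
  moreover have "(\<Sum>k=0..m. ?c k * power_exp_deriv (Suc k) v)
      = (\<Sum>k=0..m. ?c k * (real (Suc k) * v ^ k)) - (\<Sum>k=0..m. ?c k * v ^ Suc k)"
    by (simp only: power_exp_deriv_def right_diff_distrib sum_subtractf diff_Suc_1)
  ultimately show ?thesis
    unfolding laguerre_Suc_diff[symmetric] by simp
qed

text \<open>For n >= 1 only k >= 1 occurs, where 0^k vanishes and the integrals are the Stieltjes
  constants themselves. For n = 0 the term 0^0 = 1 accounts for the -1 in
  \<open>ell 0\<close>.\<close>

lemma laguerre_coeff_frac_exp: "laguerre_coeff (\<lambda>v. frac (exp v)) n = - ((-1) ^ n) * ell n"
proof (cases n)
  case 0
  have "stieltjes 0 = 1 + (\<integral>v. frac (exp v) * (- 1 * exp_weight v) \<partial>lborel)"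
    unfolding stieltjes_eq_integral by (simp add: power_exp_deriv_def)
  then show ?thesis
    by (simp add: 0 laguerre_coeff_def ell_def)
next
  case (Suc m)
  let ?c = "\<lambda>k. real (m choose k) * (-1) ^ Suc k / fact (Suc k)"
  let ?f = "\<lambda>k v. frac (exp v) * (power_exp_deriv k v * exp_weight v)"
  have int: "integrable lborel (?f k)" for k
    by (intro integrable_frac_exp integrable_power_exp_deriv)
  have "laguerre_coeff (\<lambda>v. frac (exp v)) n = (\<integral>v. (\<Sum>k=0..m. - ?c k * ?f (Suc k) v) \<partial>lborel)"
    unfolding laguerre_coeff_def Suc laguerre_Suc_eq_power_exp_deriv
    by (intro Bochner_Integration.integral_cong refl)
       (simp only: sum_negf[symmetric] sum_distrib_left sum_distrib_right mult_minus_left mult_minus_right mult_ac)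
  also have "\<dots> = (\<Sum>k=0..m. - ?c k * (\<integral>v. ?f (Suc k) v \<partial>lborel))"
    using int by (subst Bochner_Integration.integral_sum) (auto intro!: integrable_mult_right simp del: fact_Suc power_Suc)
  also have "\<dots> = (\<Sum>k=0..m. - ((-1) ^ n) * (real (m choose k) * (-1) ^ (m - k) / fact (Suc k) * stieltjes (Suc k)))"
  proof (intro sum.cong refl)
    fix k assume "k \<in> {0..m}"
    then have "m = k + (m - k)" by simp
    then have "(-1 :: real) ^ n * (-1) ^ (m - k) = (-1) ^ Suc k * ((-1) ^ (m - k) * (-1) ^ (m - k))"
      unfolding Suc by (metis (no_types, opaque_lifting) add_Suc mult.assoc power_add)
    also have "(-1 :: real) ^ (m - k) * (-1) ^ (m - k) = 1"
      by (simp flip: power_mult_distrib)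
    finally have sgn: "(-1 :: real) ^ n * (-1) ^ (m - k) = (-1) ^ Suc k"
      by simp
    have "- ((-1) ^ n) * (real (m choose k) * (-1) ^ (m - k) / fact (Suc k) * stieltjes (Suc k))
        = - (real (m choose k) * ((-1) ^ n * (-1) ^ (m - k)) / fact (Suc k)) * stieltjes (Suc k)"
      by (simp del: fact_Suc)
    also have "\<dots> = - ?c k * (\<integral>v. ?f (Suc k) v \<partial>lborel)"
      unfolding sgn stieltjes_eq_integral by simp
    finally show "- ?c k * (\<integral>v. ?f (Suc k) v \<partial>lborel)
        = - ((-1) ^ n) * (real (m choose k) * (-1) ^ (m - k) / fact (Suc k) * stieltjes (Suc k))" ..
  qed
  also have "\<dots> = - ((-1) ^ n) * (\<Sum>k=0..m. real (m choose k) * (-1) ^ (m - k) / fact (Suc k) * stieltjes (Suc k))"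
    by (rule sum_distrib_left[symmetric])
  also have "(\<Sum>k=0..m. real (m choose k) * (-1) ^ (m - k) / fact (Suc k) * stieltjes (Suc k)) = ell n"
    unfolding ell_def Suc One_nat_def sum.atLeast_Suc_atMost_Suc_shift by simp
  finally show ?thesis .
qed

section \<open>Lipschitz bounds at a point and the final case distinction\<close>

lemma abs_exp_diff_le: "\<bar>exp a - exp b\<bar> \<le> exp (max a b) * \<bar>a - b\<bar>" for a b :: real
proof (induction a b rule: linorder_wlog)
  case (le a b)
  have "exp b - exp a = exp b * (1 - exp (a - b))"
    by (simp add: right_diff_distrib flip: exp_add)
  also have "\<dots> \<le> exp b * (b - a)"
    using exp_ge_add_one_self[of "a - b"] by (intro mult_left_mono exp_ge_zero) linarith
  finally show ?case
    using le by simp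
qed (simp add: max.commute abs_minus_commute)

text \<open>Within distance d of u the Lipschitz bound of exp applies with constant exp (u + d);
  farther away the difference is at most 2B, hence at most (2B/d) |v - u|.\<close>

lemma Lipschitz_at_if_eventually_exp_shift:
  fixes h :: "real \<Rightarrow> real"
  assumes ev: "\<forall>\<^sub>F v in nhds u. h v = exp v - c" and B: "\<And>v. \<bar>h v\<bar> \<le> B"
  obtains C where "\<And>v. \<bar>h v - h u\<bar> \<le> C * \<bar>v - u\<bar>"
proof -
  from ev obtain d where d: "d > 0" "\<And>v. \<bar>v - u\<bar> < d \<Longrightarrow> h v = exp v - c"
    by (auto simp: eventually_nhds_metric dist_real_def)
  define C where "C = max (exp (u + d)) (2 * B / d)"
  have "\<bar>h v - h u\<bar> \<le> C * \<bar>v - u\<bar>" for v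
  proof (cases "\<bar>v - u\<bar> < d")
    case True
    then have "\<bar>h v - h u\<bar> = \<bar>exp v - exp u\<bar>"
      using d by simp
    also have "\<dots> \<le> exp (max v u) * \<bar>v - u\<bar>"
      by (rule abs_exp_diff_le)
    also have "\<dots> \<le> C * \<bar>v - u\<bar>"
      using True d by (intro mult_right_mono) (auto simp: C_def le_max_iff_disj)
    finally show ?thesis .
  next
    case False
    have "\<bar>h v - h u\<bar> \<le> 2 * B"
      using B[of v] B[of u] by linarith
    also have "\<dots> = 2 * B / d * d"
      using d by simp
    also have "\<dots> \<le> C * \<bar>v - u\<bar>"
      using False d B[of u] by (intro mult_mono) (auto simp: C_def le_max_iff_disj)
    finally show ?thesis .
  qed
  then show ?thesis by (rule that)
qed

text \<open>The sign (-1)^(n-1) is written as -((-1)^n) so that it is also correct at n = 0. Since x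
  > 1, being an integer means lying in {2, 3, ...}.\<close>

theorem theorem2p2:
  fixes x :: real
  assumes "x > 1"
  shows "(\<lambda>n. - ((-1) ^ n) * ell n * laguerre n (ln x)) sums
           (if x \<in> \<int> then 1 / 2 else frac x)"
proof -
  define u where "u = ln x"
  have u: "u > 0" "exp u = x"
    using assms by (auto simp: u_def)
  let ?f = "\<lambda>v::real. frac (exp v)"
  have f [measurable]: "?f \<in> borel_measurable borel"
    by (simp add: frac_def)
  have f01: "0 \<le> ?f v" "?f v \<le> 1" for v
    using frac_lt_1[of "exp v"] by (auto intro: less_imp_le)
  have near: "\<forall>\<^sub>F v in nhds u. a < exp v \<and> exp v < b" if "a < x" "x < b" for a b
    using order_tendstoD[OF tendsto_exp[OF filterlim_ident[of "nhds u"]]] that u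
    by (auto intro: eventually_conj)
  show ?thesis
  proof (cases "x \<in> \<int>")
    case False
    have "of_int \<lfloor>x\<rfloor> < x"
      using False of_int_floor_le[of x] by (metis Ints_of_int less_eq_real_def)
    then have "\<forall>\<^sub>F v in nhds u. ?f v = exp v - of_int \<lfloor>x\<rfloor>"
    proof (rule eventually_mono[OF near])
      fix v :: real assume "of_int \<lfloor>x\<rfloor> < exp v \<and> exp v < of_int \<lfloor>x\<rfloor> + 1"
      then have "\<lfloor>exp v\<rfloor> = \<lfloor>x\<rfloor>"
        by (intro floor_unique) auto
      then show "?f v = exp v - of_int \<lfloor>x\<rfloor>"
        by (simp add: frac_def)
    qed linarith
    then obtain C where "\<And>v. \<bar>?f v - ?f u\<bar> \<le> C * \<bar>v - u\<bar>"
      by (rule Lipschitz_at_if_eventually_exp_shift[where B = 1]) (use f01 in auto)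
    then have "(\<lambda>n. laguerre_coeff ?f n * laguerre n u) sums ?f u"
      using f01 u by (intro laguerre_series_sums_at_Lipschitz_point[where B = 1]) auto
    then show ?thesis
      using False u by (simp add: laguerre_coeff_frac_exp u_def)
  next
    case True
    then obtain m where m: "x = of_int m" by (auto elim: Ints_cases)
    \<comment> \<open>Adding a unit step at u removes the jump: on both sides h v = exp v - (x - 1).
      The step is closed at u so that h u = 1 fits this formula.\<close>
    define h where "h = (\<lambda>v. ?f v + indicator {u..} v)"
    have [measurable]: "h \<in> borel_measurable borel"
      unfolding h_def by measurable
    have hB: "\<bar>h v\<bar> \<le> 2" for v
      using f01[of v] by (auto simp: h_def indicator_def)
    have hu: "h u = 1"
      using u m by (simp add: h_def)
    have "\<forall>\<^sub>F v in nhds u. h v = exp v - (x - 1)"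
    proof (rule eventually_mono[OF near])
      fix v :: real assume v: "x - 1 < exp v \<and> exp v < x + 1"
      show "h v = exp v - (x - 1)"
      proof (cases "u \<le> v")
        case True
        then have "x \<le> exp v"
          using u by (metis exp_le_cancel_iff)
        with v have "\<lfloor>exp v\<rfloor> = m"
          by (intro floor_unique) (auto simp: m)
        with True show ?thesis
          by (simp add: h_def frac_def m)
      next
        case False
        then have "exp v < x"
          using u by (metis exp_less_cancel_iff not_le)
        with v have "\<lfloor>exp v\<rfloor> = m - 1"
          by (intro floor_unique) (auto simp: m)
        with False show ?thesis
          by (simp add: h_def frac_def m)
      qed
    qed auto
    then obtain C where "\<And>v. \<bar>h v - h u\<bar> \<le> C * \<bar>v - u\<bar>"
      by (rule Lipschitz_at_if_eventually_exp_shift[where B = 2]) (use hB in auto)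
    then have "(\<lambda>n. laguerre_coeff h n * laguerre n u) sums h u"
      using hB u by (intro laguerre_series_sums_at_Lipschitz_point[where B = 2]) auto
    \<comment> \<open>The result is h u = 1 minus the value 1/2 of the step's own series at its
      jump.\<close>
    from sums_diff[OF this laguerre_series_sums_at_jump[OF u(1)]]
    have "(\<lambda>n. (laguerre_coeff h n - laguerre_coeff (indicator {u<..}) n) * laguerre n u) sums (1 / 2)"
      by (simp add: hu left_diff_distrib)
    \<comment> \<open>The closed step in \<open>h\<close> and the open step subtracted here differ
      only at u, a null set.\<close>
    moreover have "laguerre_coeff h n - laguerre_coeff (indicator {u<..}) n = laguerre_coeff ?f n" for n
    proof -
      have int: "integrable lborel (\<lambda>v. h v * (laguerre n v * exp_weight v))"
        "integrable lborel (\<lambda>v. indicator {u<..} v * (laguerre n v * exp_weight v))"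
        by (rule integrable_mult_bounded[OF integrable_laguerre, where B = 2]; use hB in \<open>auto simp: indicator_def\<close>)+
      have "laguerre_coeff h n - laguerre_coeff (indicator {u<..}) n
          = (\<integral>v. h v * (laguerre n v * exp_weight v) - indicator {u<..} v * (laguerre n v * exp_weight v) \<partial>lborel)"
        using int by (simp add: laguerre_coeff_def)
      also have "\<dots> = laguerre_coeff ?f n"
        unfolding laguerre_coeff_def
      proof (rule integral_cong_AE)
        show "AE v in lborel. h v * (laguerre n v * exp_weight v) - indicator {u<..} v * (laguerre n v * exp_weight v)
            = ?f v * (laguerre n v * exp_weight v)"
          using AE_lborel_singleton[of u]
          by eventually_elim (auto simp: h_def indicator_def algebra_simps)
      qed auto
      finally show ?thesis .
    qed
    ultimately show ?thesis
      using True by (simp add: laguerre_coeff_frac_exp u_def)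
  qed
qed

end
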